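(* Let $p$ be a prime number, let $K/\mathbb{Q}_p$ be a finite extension with ramification index $e$ and residue class degree $f$, and let $t\geq 1$ be an integer. Assume that $p>e+t$. Then $$B_{\rm m}(t,K)\leq (t^2-t+1)\,(p^{f}-1).$$
   Context: For a field $K$ and an integer $t\geq 0$, $B_{\rm m}(t,K)$ denotes the supremum of the number of roots in $K^\ast=K\setminus\{0\}$, counted with multiplicities, that a non-zero polynomial in $K[x]$ with at most $t+1$ monomial terms can have. *)

theory Defs
  imports
    "HOL-Analysis.Abstract_Metric_Spaces"
    "HOL-Computational_Algebra.Computational_Algebra"
    "HOL-Algebra.Embedded_Algebras"
    "HOL-Algebra.QuotRing"
    "HOL-Library.Extended_Nat"
begin

section \<open>Non-archimedean absolute values\<close>

locale nonarch_absolute_value =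
  fixes v :: "'a::field \<Rightarrow> real"
  assumes nonneg: "0 \<le> v x"
    and eq_0_iff: "v x = 0 \<longleftrightarrow> x = 0"
    and mult: "v (x * y) = v x * v y"
    and ultrametric: "v (x + y) \<le> max (v x) (v y)"
begin

lemma v_one: "v 1 = 1"
  using mult[of 1 1] eq_0_iff[of 1] by simp

lemma v_minus: "v (- x) = v x"
proof -
  have "v (- 1) * v (- 1) = 1"
    using mult[of "- 1" "- 1"] v_one by simp
  then have "v (- 1) = 1"
    using nonneg[of "- 1"] by (simp add: square_eq_1_iff)
  then show ?thesis
    using mult[of "- 1" x] by simp
qed

lemma metric_space: "Metric_space UNIV (\<lambda>x y. v (x - y))"
proof
  fix x y z
  show "v (x - y) = v (y - x)"
    using v_minus[of "x - y"] by simp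
  show "v (x - z) \<le> v (x - y) + v (y - z)"
    using ultrametric[of "x - y" "y - z"] nonneg[of "x - y"] nonneg[of "y - z"] by simp
qed (simp_all add: nonneg eq_0_iff)

end

definition value_group :: "('a::field \<Rightarrow> real) \<Rightarrow> real monoid" where
  "value_group v = \<lparr>carrier = v ` (- {0}), monoid.mult = (*), one = 1\<rparr>"

definition valuation_ring :: "('a::field \<Rightarrow> real) \<Rightarrow> 'a ring" where
  "valuation_ring v =
     \<lparr>carrier = {x. v x \<le> 1}, monoid.mult = (*), one = 1, ring.zero = 0, add = (+)\<rparr>"

definition valuation_ideal :: "('a::field \<Rightarrow> real) \<Rightarrow> 'a set" where
  "valuation_ideal v = {x. v x < 1}"

definition residue_field :: "('a::field \<Rightarrow> real) \<Rightarrow> 'a set ring" where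
  "residue_field v = valuation_ring v Quot valuation_ideal v"


section \<open>The field of p-adic numbers\<close>

definition padic_abs :: "nat \<Rightarrow> rat \<Rightarrow> real" where
  "padic_abs p r =
     (if r = 0 then 0
      else real p powi
        (int (multiplicity (int p) (snd (quotient_of r)))
          - int (multiplicity (int p) (fst (quotient_of r)))))"

text \<open>
  A field with absolute value \<open>v\<close> is (a model of) the field of \<open>p\<close>-adic numbers with its
  \<open>p\<close>-adic absolute value if it is the completion of the rational numbers with respect to the
  \<open>p\<close>-adic absolute value: \<open>v\<close> restricts to the \<open>p\<close>-adic absolute value on the rationals, the
  field is complete, and the rationals are dense.  This determines the pair of field and absolute
  value up to unique isometric isomorphism.
\<close>

locale padic_numbers = nonarch_absolute_value v
  for p :: nat and v :: "'q::field_char_0 \<Rightarrow> real" +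
  assumes prime: "prime p"
    and extends: "v (of_rat r) = padic_abs p r"
    and complete: "Metric_space.mcomplete UNIV (\<lambda>x y. v (x - y))"
    and dense: "Metric_space.mtopology UNIV (\<lambda>x y. v (x - y)) closure_of (range of_rat) = UNIV"


section \<open>Finite extensions, ramification index and residue class degree\<close>

locale finite_field_extension =
  fixes h :: "'a::field \<Rightarrow> 'b::field"
  assumes hom_one: "h 1 = 1"
    and hom_add: "h (x + y) = h x + h y"
    and hom_mult: "h (x * y) = h x * h y"
    and finite_dimensional: "\<exists>B. finite_dimensional_vector_space (\<lambda>a x. h a * x) B"

text \<open>
  A finite extension of the \<open>p\<close>-adic numbers, given by a field embedding \<open>h\<close>, together with the
  absolute value \<open>w\<close> on the larger field that extends the \<open>p\<close>-adic absolute value \<open>v\<close>.  Since the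
  smaller field is complete, such a \<open>w\<close> exists and is unique, so \<open>w\<close> is determined by \<open>h\<close> and
  \<open>v\<close> and carries no additional data.
\<close>

locale finite_padic_extension =
  base: padic_numbers p v + finite_field_extension h + nonarch_absolute_value w
  for p :: nat and v :: "'q::field_char_0 \<Rightarrow> real"
    and h :: "'q \<Rightarrow> 'k::field" and w :: "'k \<Rightarrow> real" +
  assumes extends: "w (h a) = v a"

text \<open>The index of the value group of \<open>v\<close> in the value group of \<open>w\<close>.\<close>

definition ramification_index :: "('q::field \<Rightarrow> real) \<Rightarrow> ('k::field \<Rightarrow> real) \<Rightarrow> nat" where
  "ramification_index v w = card (rcosets\<^bsub>value_group w\<^esub> (carrier (value_group v)))"

text \<open>
  The degree of the residue field of \<open>w\<close> over the residue field of \<open>v\<close>, the latter being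
  identified with its image in the residue field of \<open>w\<close>.
\<close>

definition residue_degree ::
    "('q::field \<Rightarrow> real) \<Rightarrow> ('q \<Rightarrow> 'k::field) \<Rightarrow> ('k \<Rightarrow> real) \<Rightarrow> nat" where
  "residue_degree v h w =
     ring.dim (residue_field w)
       ((\<lambda>a. valuation_ideal w +>\<^bsub>valuation_ring w\<^esub> h a) ` carrier (valuation_ring v))
       (carrier (residue_field w))"


section \<open>Roots of polynomials with few monomials\<close>

definition num_monomials :: "'a::zero poly \<Rightarrow> nat" where
  "num_monomials P = card {i. Polynomial.coeff P i \<noteq> 0}"

text \<open>
  \<open>proots P\<close> is the multiset of roots of \<open>P\<close> in the coefficient field, with multiplicities.  The
  supremum is taken in \<open>enat\<close> because it need not be finite over an arbitrary field.
\<close>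

definition B_m :: "nat \<Rightarrow> 'k::field itself \<Rightarrow> enat" where
  "B_m t K =
     (SUP P \<in> {P :: 'k poly. P \<noteq> 0 \<and> num_monomials P \<le> t + 1}.
        enat (size {# x \<in># proots P. x \<noteq> 0 #}))"

end

theory Submission
  imports Defs
begin

text \<open>
  Let \<open>P\<close> be a nonzero polynomial with at most \<open>t + 1\<close> monomials over a finite extension of the
  \<open>p\<close>-adic numbers with ramification index \<open>e\<close> and residue field of cardinality \<open>q = p ^ f\<close>.  Its
  nonzero roots are sorted first by absolute value and then by residue class.

  \<^item> At the absolute value \<open>r\<close> of a root, the largest of the terms of \<open>P\<close> is attained at least twice
    (\<open>root_imp_two_dominant_terms\<close>), and for growing \<open>r\<close> the dominant exponents move upwards
    (\<open>dominant_terms_mono\<close>).  So at most \<open>t\<close> absolute values occur, one for each edge of the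
    Newton polygon at most.
  \<^item> The roots of absolute value \<open>r\<close> lie in at most \<open>q - 1\<close> discs \<open>w (x - x0) < w x0\<close>
    (\<open>roots_on_circle_le\<close>).
  \<^item> Each such disc contains at most \<open>t\<close> roots (\<open>roots_near_le_num_monomials\<close>).  Expand
    \<open>P (x0 (1 + y))\<close> in powers of \<open>y\<close> with coefficients \<open>c k\<close>.  The numbers \<open>fact k * c k\<close> are the
    values of one linear functional at the falling factorials, regarded as integer polynomials in
    the exponent, and this functional vanishes on multiples of a monic polynomial of degree at
    most \<open>t + 1\<close>.  Therefore all of them are bounded by those with \<open>k \<le> t\<close>.  As \<open>p > e + t\<close>, the
    factorials are too close to units to compensate the decay of \<open>y ^ k\<close>, so the Gauss norm of the
    expansion is last attained at an index at most \<open>t\<close>, which bounds the number of roots in the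
    disc (\<open>size_roots_in_disc_le_dominant_index\<close>).

  Altogether this gives \<open>t * t * (q - 1)\<close>.  The improvement concerns the case in which exactly \<open>t\<close>
  absolute values occur.  Then there are \<open>t + 1\<close> exponents, and each absolute value belongs to a
  pair of consecutive ones.  For the pair whose difference has the least \<open>p\<close>-adic valuation,
  that power of \<open>p\<close> divides all differences of exponents, and the same argument
  shows that each disc contains at most one root (\<open>roots_near_le_1\<close>).  The total is
  \<open>((t - 1) * t + 1) * (q - 1)\<close>.

  What is needed about the field is that \<open>w x < 1\<close> implies \<open>w x \<le> \<rho>\<close>, where \<open>\<rho> ^ e = 1 / p\<close>, and
  that there are at most \<open>p ^ f\<close> residue classes.  The former is Lagrange's theorem for the value
  groups (\<open>power_ramification_index\<close>), the latter a count of linear combinations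
  (\<open>finite_residue_field\<close>); the finiteness of index and degree follows from the finite dimension.
\<close>


section \<open>Sums in a non-archimedean field\<close>

context nonarch_absolute_value
begin

lemma power: "v (x ^ n) = v x ^ n"
  by (induction n) (simp_all add: v_one mult)

lemma v_zero [simp]: "v 0 = 0"
  by (simp add: eq_0_iff)

lemma v_pos: "x \<noteq> 0 \<Longrightarrow> 0 < v x"
  using nonneg[of x] eq_0_iff[of x] by linarith

lemma divide: "v (x / y) = v x / v y"
proof (cases "y = 0")
  case False
  then have "v (x / y) * v y = v x"
    using mult[of "x / y" y] by simp
  then show ?thesis
    using v_pos[OF False] by (simp add: field_simps)
qed simp

lemma v_diff_commute: "v (x - y) = v (y - x)"
  using v_minus[of "x - y"] by simp

lemma diff_le: "v (x - y) \<le> max (v x) (v y)"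
  using ultrametric[of x "- y"] by (simp add: v_minus)

lemma add_dominant:
  assumes "v x < v y"
  shows "v (x + y) = v y"
  using ultrametric[of x y] diff_le[of "x + y" x] assms by simp

lemma close_imp_eq:
  assumes "v (x - y) < v y"
  shows "v x = v y"
  using add_dominant[of "x - y" y] assms by simp

lemma sum_le:
  assumes "0 \<le> M" "\<And>i. i \<in> A \<Longrightarrow> v (f i) \<le> M"
  shows "v (sum f A) \<le> M"
  using assms(2)
proof (induction A rule: infinite_finite_induct)
  case (insert a A)
  then have "max (v (f a)) (v (sum f A)) \<le> M" by simp
  with ultrametric[of "f a" "sum f A"] have "v (f a + sum f A) \<le> M"
    by (rule order_trans)
  then show ?case using insert.hyps by simp
qed (use assms(1) in auto)

lemma sum_less:
  assumes "0 < M" "\<And>i. i \<in> A \<Longrightarrow> v (f i) < M"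
  shows "v (sum f A) < M"
  using assms(2)
proof (induction A rule: infinite_finite_induct)
  case (insert a A)
  then have "max (v (f a)) (v (sum f A)) < M" by simp
  with ultrametric[of "f a" "sum f A"] have "v (f a + sum f A) < M"
    by (rule le_less_trans)
  then show ?case using insert.hyps by simp
qed (use assms(1) in auto)

lemma sum_dominant:
  assumes "finite A" "a \<in> A" "\<And>i. i \<in> A \<Longrightarrow> i \<noteq> a \<Longrightarrow> v (f i) < v (f a)" 
  shows "v (sum f A) = v (f a)"
proof (cases "f a = 0")
  case True
  have "f i = 0" if "i \<in> A" for i
    using assms(3)[OF that] True nonneg[of "f i"] by (cases "i = a") auto
  then show ?thesis by (simp add: True)
next
  case False
  have "v (sum f (A - {a})) < v (f a)"
    by (rule sum_less) (use v_pos[OF False] assms in auto)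
  then have "v (sum f (A - {a}) + f a) = v (f a)"
    by (rule add_dominant)
  then show ?thesis
    using sum.remove[OF assms(1,2), of f] by (simp add: add.commute)
qed

lemma of_int_le_1: "v (of_int z) \<le> 1"
proof -
  have *: "v (of_nat n) \<le> 1" for n
  proof (induction n)
    case (Suc n)
    then show ?case
      using ultrametric[of 1 "of_nat n"] by (simp add: v_one)
  qed simp
  show ?thesis
    using *[of "nat z"] *[of "nat (- z)"] v_minus[of "of_int z"] by (cases "0 \<le> z") (auto simp: of_nat_nat)
qed

lemma of_int_dvd_le:
  assumes "d dvd z"
  shows "v (of_int z) \<le> v (of_int d)"
proof -
  obtain k where "z = d * k" using assms by blast
  then show ?thesis
    using of_int_le_1[of k] nonneg[of "of_int d"] by (simp add: mult mult_left_le)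
qed

end


section \<open>Counting the roots in a disc\<close>

context nonarch_absolute_value
begin

text \<open>
  The last index at which the Gauss norm of \<open>Q\<close> for the radius \<open>\<rho>\<close> is attained.  In terms of
  Newton polygons it is the right end of the edge of slope determined by \<open>\<rho>\<close>, and over an
  algebraically closed field it would be the exact number of roots in the disc of radius \<open>\<rho>\<close>.
\<close>

definition dominant_index :: "real \<Rightarrow> 'a poly \<Rightarrow> nat \<Rightarrow> bool" where
  "dominant_index \<rho> Q n \<longleftrightarrow> Polynomial.coeff Q n \<noteq> 0 \<and>
     (\<forall>k. v (Polynomial.coeff Q k) * \<rho> ^ k \<le> v (Polynomial.coeff Q n) * \<rho> ^ n) \<and>
     (\<forall>k>n. v (Polynomial.coeff Q k) * \<rho> ^ k < v (Polynomial.coeff Q n) * \<rho> ^ n)"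

lemma dominant_index_exists:
  assumes "Q \<noteq> 0" "0 < \<rho>"
  shows "\<exists>n. dominant_index \<rho> Q n"
proof -
  define g where "g k = v (Polynomial.coeff Q k) * \<rho> ^ k" for k
  define m where "m = Max (g ` {..Polynomial.degree Q})"
  define N where "N = {k. k \<le> Polynomial.degree Q \<and> g k = m}"
  have le: "g k \<le> m" if "k \<le> Polynomial.degree Q" for k
    unfolding m_def using that by (intro Max_ge) auto
  have "m \<in> g ` {..Polynomial.degree Q}" unfolding m_def by (intro Max_in) auto
  then have N: "finite N" "N \<noteq> {}" by (auto simp: N_def)
  have "0 < g (Polynomial.degree Q)"
    using v_pos[of "lead_coeff Q"] assms by (simp add: g_def)
  then have mpos: "0 < m"
    using le[of "Polynomial.degree Q"] by simp
  have high: "g k = 0" if "k > Polynomial.degree Q" for k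
    using that by (simp add: g_def coeff_eq_0)
  define n where "n = Max N"
  have n: "n \<in> N" unfolding n_def using N by (rule Max_in)
  have gt: "k \<notin> N" if "k > n" for k
    using Max_ge[OF N(1), of k] that by (auto simp: n_def)
  have gn: "g n = m" using n by (simp add: N_def)
  have a: "g k \<le> g n" for k
    using le[of k] high[of k] mpos gn by (cases "k \<le> Polynomial.degree Q") auto
  have b: "g k < g n" if "k > n" for k
  proof (cases "k \<le> Polynomial.degree Q")
    case True
    then show ?thesis using gt[OF that] le[of k] gn by (auto simp: N_def)
  qed (use high[of k] mpos gn in auto)
  have "Polynomial.coeff Q n \<noteq> 0" using gn mpos by (auto simp: g_def)
  then show ?thesis
    using a b unfolding dominant_index_def g_def by blast
qed

text \<open>
  A linear factor whose root lies in the disc has its Gauss norm attained at the leading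
  coefficient.  In the coefficient of index \<open>Suc n\<close> of the product the contribution of this leading
  coefficient is strictly larger than the other one, so nothing cancels; every later coefficient
  is a sum of two contributions that are strictly smaller.
\<close>

lemma dominant_index_mult_linear:
  assumes Q: "dominant_index \<rho> Q n" and \<rho>: "0 < \<rho>" and c: "c \<noteq> 0" and u: "v u \<le> \<rho> * v c"
  shows "dominant_index \<rho> ([:u, c:] * Q) (Suc n)"
proof -
  define g where "g k = v (Polynomial.coeff Q k) * \<rho> ^ k" for k
  define G where "G = v c * \<rho> * g n"
  define a where "a k = u * Polynomial.coeff Q k" for k
  define b where "b k = (case k of 0 \<Rightarrow> 0 | Suc j \<Rightarrow> c * Polynomial.coeff Q j)" for k
  have co: "Polynomial.coeff ([:u, c:] * Q) k = a k + b k" for k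
    by (simp add: mult_pCons_left a_def b_def coeff_pCons split: nat.split)
  have gle: "g k \<le> g n" and gless: "k > n \<Longrightarrow> g k < g n" for k
    using Q by (auto simp: dominant_index_def g_def)
  have g0: "0 \<le> g k" for k using \<rho> by (simp add: g_def nonneg)
  have vc: "0 < v c" using c by (rule v_pos)
  have gn: "0 < g n" using Q \<rho> v_pos by (auto simp: dominant_index_def g_def)
  then have G: "0 < G" using vc \<rho> by (simp add: G_def)
  have a: "v (a k) * \<rho> ^ k \<le> v c * \<rho> * g k" for k
    using mult_right_mono[OF u g0[of k]] by (simp add: a_def g_def mult mult_ac)
  have aG: "v (a k) * \<rho> ^ k \<le> G" for k
    using order_trans[OF a[of k] mult_left_mono[OF gle[of k], of "v c * \<rho>"]] vc \<rho> by (simp add: G_def)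
  have aG': "v (a k) * \<rho> ^ k < G" if "k > n" for k
    using le_less_trans[OF a[of k] mult_strict_left_mono[OF gless[OF that], of "v c * \<rho>"]] vc \<rho>
    by (simp add: G_def)
  have b: "v (b (Suc k)) * \<rho> ^ Suc k = v c * \<rho> * g k" for k
    by (simp add: b_def g_def mult)
  have bG: "v (b k) * \<rho> ^ k \<le> G" for k
  proof (cases k)
    case (Suc j)
    then show ?thesis
      using b[of j] mult_left_mono[OF gle[of j], of "v c * \<rho>"] vc \<rho> by (simp add: G_def)
  qed (use G in \<open>simp add: b_def\<close>)
  have bG': "v (b k) * \<rho> ^ k < G" if "k > Suc n" for k
  proof (cases k)
    case (Suc j)
    then show ?thesis
      using b[of j] mult_strict_left_mono[OF gless[of j], of "v c * \<rho>"] vc \<rho> that by (simp add: G_def)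
  qed (use that in simp)
  have bn: "v (b (Suc n)) * \<rho> ^ Suc n = G"
    using b[of n] by (simp add: G_def)
  have "v (a (Suc n)) * \<rho> ^ Suc n < v (b (Suc n)) * \<rho> ^ Suc n"
    using aG'[of "Suc n"] bn by simp
  then have "v (a (Suc n)) < v (b (Suc n))"
    using \<rho> by (simp add: mult_less_cancel_right del: power_Suc)
  then have top: "v (a (Suc n) + b (Suc n)) * \<rho> ^ Suc n = G"
    using add_dominant bn by metis
  have add: "v (a k + b k) * \<rho> ^ k \<le> max (v (a k) * \<rho> ^ k) (v (b k) * \<rho> ^ k)" for k
    using mult_right_mono[OF ultrametric[of "a k" "b k"], of "\<rho> ^ k"] \<rho>
    by (simp add: max_mult_distrib_right)
  have nz: "a (Suc n) + b (Suc n) \<noteq> 0"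
    using top G by auto
  show ?thesis
    unfolding dominant_index_def co top using nz add aG bG aG' bG'
    by (meson Suc_lessD le_less_trans max.bounded_iff max_less_iff_conj order_trans)
qed

text \<open>
  Each root in the disc splits off a linear factor, and each such factor raises the dominant
  index by exactly one.  The affine substitution moves the centre of the disc to \<open>0\<close>; it is kept
  in the statement so that the multiset of roots need not be transported along it.
\<close>

lemma size_roots_in_disc_le_dominant_index:
  assumes "P \<noteq> 0" "0 < \<rho>" "c \<noteq> 0" "dominant_index \<rho> (pcompose P [:z, c:]) n"
  shows "size {#x \<in># proots P. v (x - z) \<le> \<rho> * v c#} \<le> n"
  using assms
proof (induction "Polynomial.degree P" arbitrary: P n rule: less_induct)
  case less
  show ?case
  proof (cases "\<exists>a. poly P a = 0 \<and> v (a - z) \<le> \<rho> * v c")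
    case True
    then obtain a G where a: "v (a - z) \<le> \<rho> * v c" and P: "P = [:- a, 1:] * G"
      by (auto simp: poly_eq_0_iff_dvd dvd_def)
    have G: "G \<noteq> 0" using P less.prems by auto
    have "Polynomial.degree G < Polynomial.degree P" unfolding P using G by (subst degree_mult_eq) auto
    moreover have comp: "pcompose P [:z, c:] = [:z - a, c:] * pcompose G [:z, c:]"
      unfolding P pcompose_mult by (simp add: pcompose_pCons)
    have Gc: "pcompose G [:z, c:] \<noteq> 0"
      using less.prems(4) unfolding comp by (auto simp: dominant_index_def)
    then obtain m where m: "dominant_index \<rho> (pcompose G [:z, c:]) m"
      using dominant_index_exists less.prems by blast
    have "dominant_index \<rho> (pcompose P [:z, c:]) (Suc m)"
      unfolding comp using m less.prems a
      by (intro dominant_index_mult_linear) (auto simp: v_diff_commute)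
    then have "n = Suc m"
      using less.prems(4) unfolding dominant_index_def
      by (metis linorder_neqE_nat not_less)
    moreover have "proots P = add_mset a (proots G)"
      unfolding P using G by (subst proots_mult) auto
    ultimately show ?thesis
      using less.hyps[of G m] G less.prems m a by simp
  next
    case False
    then have none: "filter_mset (\<lambda>x. v (x - z) \<le> \<rho> * v c) (proots P) = {#}"
      using less.prems(1) by (intro multiset_eqI) (auto, metis order_root)
    show ?thesis by (simp only: none size_empty le0)
  qed
qed

end


section \<open>The p-adic valuation of factorials\<close>

text \<open>
  Among \<open>1, \<dots>, k\<close> only the multiples \<open>p, 2p, \<dots>\<close> of \<open>p\<close> contribute, and dividing
  each of them by \<open>p\<close> leaves the factorial of \<open>k div p\<close>.  This is one step of Legendre's formula.
\<close>

lemma multiplicity_fact_step: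
  fixes p :: nat
  assumes "prime p"
  shows "multiplicity p (fact k :: nat) = k div p + multiplicity p (fact (k div p) :: nat)"
proof (induction k)
  case (Suc k)
  have p: "p > 1" using assms prime_gt_1_nat by blast
  have step: "multiplicity p (fact (Suc n) :: nat) = multiplicity p (Suc n) + multiplicity p (fact n :: nat)" for n
    using assms by (simp add: prime_elem_multiplicity_mult_distrib del: mult_Suc)
  show ?case
  proof (cases "p dvd Suc k")
    case True
    then obtain m where m: "Suc k = p * m" by blast
    then have m0: "m \<noteq> 0" by (intro notI) simp
    have div: "Suc k div p = Suc (k div p)"
      using True p by (simp add: div_Suc dvd_eq_mod_eq_0)
    then have "m = Suc (k div p)" using m p by simp
    moreover have "multiplicity p (Suc k) = Suc (multiplicity p m)"
      unfolding m using m0 p by (intro multiplicity_times_same) auto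
    ultimately show ?thesis
      using step[of k] step[of "k div p"] Suc.IH div by simp
  next
    case False
    then have "Suc k div p = k div p" by (simp add: div_Suc dvd_eq_mod_eq_0)
    then show ?thesis
      using step[of k] Suc.IH False by (simp add: not_dvd_imp_multiplicity_0)
  qed
qed simp

lemma multiplicity_fact_bound:
  fixes p k :: nat
  assumes "prime p" "0 < k"
  shows "(p - 1) * multiplicity p (fact k :: nat) < k"
  using assms(2)
proof (induction k rule: less_induct)
  case (less k)
  have p: "p > 1" using assms prime_gt_1_nat by blast
  define m where "m = k div p"
  show ?case
  proof (cases "m = 0")
    case False
    have "m < k" using less.prems p by (simp add: m_def)
    then have "(p - 1) * multiplicity p (fact m :: nat) < m" using False less.IH by simp
    then have "(p - 1) * multiplicity p (fact k :: nat) < (p - 1) * m + m"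
      using multiplicity_fact_step[OF assms(1), of k] by (simp add: m_def algebra_simps)
    also have "\<dots> = p * m" using p by (cases p) auto
    also have "\<dots> \<le> k" by (simp add: m_def)
    finally show ?thesis .
  qed (use multiplicity_fact_step[OF assms(1), of k] less.prems in \<open>simp add: m_def\<close>)
qed

text \<open>
  This is where the size of \<open>p\<close> enters.  If \<open>k < p\<close>, the factorial is prime to \<open>p\<close>.  Otherwise
  \<open>(p - 1) * multiplicity p (fact k) \<le> k - 1\<close> and \<open>e \<le> p - s - 1\<close>, and
  \<open>(p - 1) (k - s) - (p - s - 1) (k - 1) = s (k - p) + (p - 1)\<close> is positive.
\<close>

lemma ramified_fact_bound:
  fixes p e s k :: nat
  assumes "prime p" "e + s < p" "s < k"
  shows "e * multiplicity p (fact k :: nat) < k - s"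
proof (cases "k < p")
  case True
  then have "multiplicity p (fact k :: nat) = 0"
    using multiplicity_fact_step[OF assms(1), of k] by simp
  then show ?thesis using assms by simp
next
  case False
  define \<mu> where "\<mu> = int (multiplicity p (fact k :: nat))"
  have p: "p > 1" using assms prime_gt_1_nat by blast
  have "int ((p - 1) * multiplicity p (fact k :: nat)) < int k"
    using multiplicity_fact_bound[of p k] assms by (simp only: of_nat_less_iff)
  then have \<mu>: "(int p - 1) * \<mu> \<le> int k - 1"
    using p by (simp add: \<mu>_def of_nat_diff)
  have "(int p - 1) * (int e * \<mu>) = int e * ((int p - 1) * \<mu>)" by simp
  also have "\<dots> \<le> int e * (int k - 1)" using \<mu> by (intro mult_left_mono) auto
  also have "\<dots> \<le> (int p - int s - 1) * (int k - 1)"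
    using assms by (intro mult_right_mono) auto
  also have "\<dots> < (int p - 1) * (int k - int s)"
  proof -
    have "0 \<le> int s * (int k - int p)" using False by (intro mult_nonneg_nonneg) auto
    moreover have "(int p - 1) * (int k - int s)
        = (int p - int s - 1) * (int k - 1) + int s * (int k - int p) + (int p - 1)"
      by (simp add: algebra_simps)
    ultimately show ?thesis using p by linarith
  qed
  finally have "int e * \<mu> < int k - int s" using p by simp
  then show ?thesis using assms unfolding \<mu>_def by (simp flip: of_nat_mult)
qed


section \<open>Taylor coefficients of sparse polynomials\<close>

definition falling_poly :: "nat \<Rightarrow> int poly" where
  "falling_poly k = (\<Prod>j<k. [:- int j, 1:])"

lemma poly_falling_poly: "poly (falling_poly k) (int i) = int (fact k * (i choose k))"
proof -
  have "real (fact k * (i choose k)) = (\<Prod>j<k. real i - real j)"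
    using gbinomial_mult_fact[of k "real i"] by (simp add: binomial_gbinomial lessThan_atLeast0)
  then have "real_of_int (int (fact k * (i choose k))) = real_of_int (\<Prod>j<k. int i - int j)"
    by simp
  then have "int (fact k * (i choose k)) = (\<Prod>j<k. int i - int j)"
    by (simp only: of_int_eq_iff)
  then show ?thesis by (simp add: falling_poly_def poly_prod)
qed

lemma degree_prod_monic_linear:
  fixes f :: "'b \<Rightarrow> 'a::idom"
  shows "Polynomial.degree (\<Prod>j\<in>A. [:f j, 1:]) = card A"
    and "lead_coeff (\<Prod>j\<in>A. [:f j, 1:]) = 1"
proof -
  show "Polynomial.degree (\<Prod>j\<in>A. [:f j, 1:]) = card A"
    by (subst degree_prod_eq_sum_degree) auto
  show "lead_coeff (\<Prod>j\<in>A. [:f j, 1:]) = 1"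
    by (simp add: lead_coeff_prod)
qed

text \<open>
  Monic integer polynomials, one of each degree, form a basis of the additive group of all
  integer polynomials, because a leading coefficient can be removed without division.
\<close>

lemma int_poly_induct_monic_basis [case_names monic zero step]:
  fixes G :: "nat \<Rightarrow> int poly"
  assumes G: "\<And>d. Polynomial.degree (G d) = d \<and> lead_coeff (G d) = 1"
    and zero: "A 0"
    and step: "\<And>F c d. A F \<Longrightarrow> A (F + Polynomial.smult c (G d))"
  shows "A F"
proof (induction "Polynomial.degree F" arbitrary: F rule: less_induct)
  case less
  define c where "c = lead_coeff F"
  define H where "H = F - Polynomial.smult c (G (Polynomial.degree F))"
  have H: "Polynomial.degree H \<le> Polynomial.degree F" "Polynomial.coeff H (Polynomial.degree F) = 0"
    using G[of "Polynomial.degree F"] by (auto simp: H_def c_def intro: degree_diff_le)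
  have "A H"
  proof (cases "H = 0")
    case False
    then have "Polynomial.degree H < Polynomial.degree F"
      using H by (metis leading_coeff_0_iff order_le_imp_less_or_eq)
    then show ?thesis by (rule less.hyps)
  qed (use zero in simp)
  then have "A (H + Polynomial.smult c (G (Polynomial.degree F)))" by (rule step)
  then show ?case by (simp add: H_def)
qed

lemma pcompose_monom:
  "pcompose (Polynomial.monom c n) q = Polynomial.smult c (q ^ n)" for c :: "'a::comm_semiring_1"
  by (induction n) (simp_all add: monom_0 monom_Suc pcompose_pCons)

lemma coeff_dilated_linear_power:
  "Polynomial.coeff ([:x, x:] ^ i) k = x ^ i * of_nat (i choose k)" for x :: "'a::comm_ring_1"
proof -
  have "Polynomial.coeff ([:1, 1::'a:] ^ i) k = of_nat (i choose k)"
  proof (cases "k \<le> i")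
    case False
    have "Polynomial.degree ([:1, 1::'a:] ^ i) \<le> i" using degree_power_le[of "[:1,1::'a:]" i] by simp
    then show ?thesis using False by (simp add: coeff_eq_0 binomial_eq_0)
  qed (simp add: coeff_linear_poly_power)
  moreover have "[:x, x:] = Polynomial.smult x [:1, 1:]" by simp
  ultimately show ?thesis by (simp only: smult_power coeff_smult)
qed

definition support :: "'a::zero poly \<Rightarrow> nat set" where
  "support P = {i. Polynomial.coeff P i \<noteq> 0}"

lemma finite_support [simp]: "finite (support P)"
  unfolding support_def using MOST_coeff_eq_0[of P] by (simp add: eventually_cofinite)

lemma poly_eq_sum_support: "poly P x = (\<Sum>i\<in>support P. Polynomial.coeff P i * x ^ i)"
  for x :: "'a::comm_semiring_1"
  unfolding poly_altdef
  by (intro sum.mono_neutral_right) (auto simp: support_def le_degree)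

text \<open>
  The value at \<open>x\<close> of \<open>F(X d/dX) P\<close>, where \<open>X d/dX\<close> is the Euler operator, whose eigenvectors
  are the monomials.  It is a linear functional of \<open>F\<close> and depends only on the
  values of \<open>F\<close> at the exponents of \<open>P\<close>.
\<close>

definition support_functional :: "'a::field poly \<Rightarrow> 'a \<Rightarrow> int poly \<Rightarrow> 'a" where
  "support_functional P x F =
     (\<Sum>i\<in>support P. Polynomial.coeff P i * x ^ i * of_int (poly F (int i)))"

text \<open>
  After the substitution \<open>y \<mapsto> x (1 + y)\<close> the monomial of degree \<open>i\<close> contributes
  \<open>x ^ i * (i choose k)\<close> to the coefficient of index \<open>k\<close>.  Multiplying by \<open>fact k\<close> turns the
  binomial coefficient into a polynomial in \<open>i\<close> with integer coefficients.
\<close>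

lemma fact_coeff_eq_support_functional:
  "of_nat (fact k) * Polynomial.coeff (pcompose P [:x, x:]) k = support_functional P x (falling_poly k)"
proof -
  have "pcompose P [:x, x:] = (\<Sum>i\<le>Polynomial.degree P. Polynomial.smult (Polynomial.coeff P i) ([:x, x:] ^ i))"
    by (subst poly_as_sum_of_monoms[of P, symmetric], subst pcompose_sum) (simp add: pcompose_monom)
  then have "of_nat (fact k) * Polynomial.coeff (pcompose P [:x, x:]) k
      = (\<Sum>i\<le>Polynomial.degree P. Polynomial.coeff P i * x ^ i * of_int (poly (falling_poly k) (int i)))"
    by (simp add: coeff_sum coeff_dilated_linear_power poly_falling_poly sum_distrib_left mult_ac del: of_nat_fact)
  also have "\<dots> = support_functional P x (falling_poly k)"
    unfolding support_functional_def
    by (intro sum.mono_neutral_right) (auto simp: support_def le_degree)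
  finally show ?thesis .
qed

lemma support_functional_add_smult:
  "support_functional P x (F + Polynomial.smult c G) = support_functional P x F + of_int c * support_functional P x G"
  by (simp add: support_functional_def sum_distrib_left sum.distrib algebra_simps)

text \<open>
  The functional kills every multiple of the monic polynomial whose roots are the exponents of
  \<open>P\<close>.  So only polynomials of degree at most \<open>t\<close> matter, and these are integer combinations of
  the first falling factorials.  Working with integer combinations instead of Lagrange interpolation
  avoids denominators, which would involve differences of exponents.
\<close>

lemma (in nonarch_absolute_value) support_functional_le:
  assumes "card (support P) \<le> Suc t" "0 \<le> M"
    and le: "\<And>j. j \<le> t \<Longrightarrow> v (support_functional P x (falling_poly j)) \<le> M"
  shows "v (support_functional P x F) \<le> M"
proof -
  define m where "m = card (support P)"
  define N where "N = (\<Prod>i\<in>support P. [:- int i, 1:])"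
  \<comment> \<open>A monic basis: falling factorials in low degrees, then multiples of \<open>N\<close>, on which the functional vanishes.\<close>
  define G where "G d = (if d < m then falling_poly d else N * Polynomial.monom 1 (d - m))" for d
  have N: "Polynomial.degree N = m" "lead_coeff N = 1" "N \<noteq> 0"
    using degree_prod_monic_linear[of "\<lambda>i. - int i" "support P"] unfolding N_def m_def by auto
  have G: "Polynomial.degree (G d) = d \<and> lead_coeff (G d) = 1" for d
  proof (cases "d < m")
    case True
    then show ?thesis
      using degree_prod_monic_linear[of "\<lambda>j. - int j" "{..<d}"] by (simp add: G_def falling_poly_def)
  next
    case False
    have "Polynomial.degree (N * Polynomial.monom 1 (d - m)) = m + (d - m)"
      using N by (subst degree_mult_eq) (auto simp: degree_monom_eq)
    moreover have "lead_coeff (N * Polynomial.monom 1 (d - m)) = 1"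
      using N by (simp add: lead_coeff_mult degree_monom_eq)
    ultimately show ?thesis using False by (simp add: G_def)
  qed
  have GM: "v (support_functional P x (G d)) \<le> M" for d
  proof (cases "d < m")
    case True
    then show ?thesis using le[of d] assms(1) by (simp add: G_def m_def)
  next
    case False
    have "poly N (int i) = 0" if "i \<in> support P" for i
      using that by (auto simp: N_def poly_prod)
    then have "support_functional P x (G d) = 0"
      using False by (simp add: support_functional_def G_def)
    then show ?thesis using assms(2) by simp
  qed
  show ?thesis
  proof (induction F rule: int_poly_induct_monic_basis[of G])
    case (monic d)
    show ?case by (rule G)
  next
    case (step F c d)
    have "v (of_int c * support_functional P x (G d)) \<le> M"
      using mult_mono[OF of_int_le_1[of c] GM[of d]] nonneg by (simp add: mult)
    with step have "max (v (support_functional P x F)) (v (of_int c * support_functional P x (G d))) \<le> M"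
      by simp
    then show ?case
      unfolding support_functional_add_smult by (rule order_trans[OF ultrametric])
  qed (use assms(2) in \<open>simp add: support_functional_def\<close>)
qed


section \<open>Roots close to a given root\<close>

lemma diff_dvd_poly_diff: "a - b dvd poly F a - poly F b" for a :: "'a::comm_ring_1"
proof (induction F)
  case (pCons c F)
  have "poly (pCons c F) a - poly (pCons c F) b = a * (poly F a - poly F b) + (a - b) * poly F b"
    by (simp add: algebra_simps)
  then show ?case using pCons.IH by (metis dvd_add dvd_mult dvd_triv_left)
qed simp

text \<open>
  The properties of a finite extension of the \<open>p\<close>-adic numbers that concern its value group: \<open>e\<close> is
  the ramification index and \<open>\<rho>\<close> the absolute value of a uniformizer, so that the open unit disc
  is the closed disc of radius \<open>\<rho>\<close>.
\<close>

locale ramified_field = nonarch_absolute_value w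
  for w :: "'k::field \<Rightarrow> real" +
  fixes p e :: nat and \<rho> :: real
  assumes prime: "prime p"
    and w_of_nat: "0 < n \<Longrightarrow> w (of_nat n) = (1 / real p) ^ multiplicity p n"
    and \<rho>_pos: "0 < \<rho>" and \<rho>_less_1: "\<rho> < 1" and \<rho>_power: "\<rho> ^ e = 1 / real p"
    and less_1_imp_le: "w x < 1 \<Longrightarrow> w x \<le> \<rho>"
begin

lemma p_gt_1: "1 < p"
  using prime prime_gt_1_nat by blast

lemma \<rho>_power_less_fact:
  assumes "e + s < p" "s < k"
  shows "\<rho> ^ (k - s) < w (of_nat (fact k))"
proof -
  have "\<rho> ^ (k - s) < \<rho> ^ (e * multiplicity p (fact k :: nat))"
    using ramified_fact_bound[OF prime assms] \<rho>_pos \<rho>_less_1 by (intro power_strict_decreasing) auto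
  also have "\<dots> = w (of_nat (fact k))"
    by (subst w_of_nat) (simp_all add: power_mult \<rho>_power)
  finally show ?thesis .
qed

abbreviation roots_near :: "'k poly \<Rightarrow> 'k \<Rightarrow> nat" where
  "roots_near P x0 \<equiv> size {#x \<in># proots P. w (x - x0) < w x0#}"

text \<open>
  Suppose that a Taylor coefficient of index at most \<open>s\<close> bounds \<open>fact k\<close> times every Taylor
  coefficient.  Passing from index at most \<open>s\<close> to an index \<open>k > s\<close> costs at most a factor
  \<open>1 / fact k\<close> in the coefficient but gains a factor \<open>\<rho> ^ (k - s)\<close>, which outweighs it.  Hence the
  dominant index is at most \<open>s\<close>.
\<close>

lemma roots_near_le:
  assumes P: "P \<noteq> 0" and x0: "x0 \<noteq> 0" and s: "e + s < p" and j: "j \<le> s"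
    and le: "\<And>k. w (of_nat (fact k) * Polynomial.coeff (pcompose P [:x0, x0:]) k)
                  \<le> w (Polynomial.coeff (pcompose P [:x0, x0:]) j)"
  shows "roots_near P x0 \<le> s"
proof -
  define Q where "Q = pcompose P [:x0, x0:]"
  define c where "c = Polynomial.coeff Q"
  have fact_pos: "0 < w (of_nat (fact k))" for k
    using p_gt_1 by (subst w_of_nat) auto
  have Q: "Q \<noteq> 0"
    using P x0 pcompose_eq_0[of P "[:x0, x0:]"] by (auto simp: Q_def)
  have le: "w (of_nat (fact k)) * w (c k) \<le> w (c j)" for k
    using le[of k] by (simp add: mult c_def Q_def)
  have cj: "0 < w (c j)"
    using le[of "Polynomial.degree Q"] fact_pos[of "Polynomial.degree Q"] v_pos[of "lead_coeff Q"] Q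
    by (simp add: c_def) (meson less_le_trans mult_pos_pos)
  have small: "w (c k) * \<rho> ^ k < w (c j) * \<rho> ^ j" if k: "s < k" for k
  proof (cases "c k = 0")
    case False
    have "w (c k) * \<rho> ^ k = (w (c k) * \<rho> ^ (k - s)) * \<rho> ^ s"
      using k by (simp flip: power_add)
    also have "\<dots> < (w (c k) * w (of_nat (fact k))) * \<rho> ^ s"
      using \<rho>_power_less_fact[OF s k] v_pos[OF False] \<rho>_pos by simp
    also have "\<dots> \<le> w (c j) * \<rho> ^ s"
      using le[of k] \<rho>_pos by (simp add: mult_ac)
    also have "\<dots> \<le> w (c j) * \<rho> ^ j"
      using j \<rho>_pos \<rho>_less_1 cj by (intro mult_left_mono power_decreasing) auto
    finally show ?thesis .
  qed (use cj \<rho>_pos in simp)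
  obtain n where n: "dominant_index \<rho> Q n"
    using dominant_index_exists[OF Q \<rho>_pos] by blast
  then have "n \<le> s"
    using small[of n] unfolding dominant_index_def c_def by (meson not_less)
  have near: "w (x - x0) \<le> \<rho> * w x0" if "w (x - x0) < w x0" for x
  proof -
    have "w ((x - x0) / x0) \<le> \<rho>"
      using that v_pos[OF x0] by (intro less_1_imp_le) (simp add: divide)
    then show ?thesis using v_pos[OF x0] by (simp add: divide field_simps)
  qed
  have "roots_near P x0 \<le> size {#x \<in># proots P. w (x - x0) \<le> \<rho> * w x0#}"
    by (intro size_mset_mono mset_subset_eqI) (simp add: near)
  also have "\<dots> \<le> n"
    using size_roots_in_disc_le_dominant_index[OF P \<rho>_pos x0] n by (simp add: Q_def)
  finally show ?thesis using \<open>n \<le> s\<close> by simp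
qed

lemma support_functional_falling:
  "w (support_functional P x (falling_poly k))
     = w (of_nat (fact k) * Polynomial.coeff (pcompose P [:x, x:]) k)"
  by (simp only: fact_coeff_eq_support_functional)

lemma of_nat_le_1: "w (of_nat n) \<le> 1"
  using of_int_le_1[of "int n"] by simp

text \<open>
  By \<open>support_functional_le\<close> the largest of the values \<open>fact j\<close> times the coefficient of index
  \<open>j \<le> t\<close> bounds all the others, so \<open>roots_near_le\<close> applies with \<open>s = t\<close>.
\<close>

lemma roots_near_le_num_monomials:
  assumes P: "P \<noteq> 0" and x0: "x0 \<noteq> 0" and "e + t < p" and t: "card (support P) \<le> Suc t"
  shows "roots_near P x0 \<le> t"
proof -
  define L where "L F = w (support_functional P x0 F)" for F
  define M where "M = Max ((\<lambda>j. L (falling_poly j)) ` {..t})"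
  have "M \<in> (\<lambda>j. L (falling_poly j)) ` {..t}" unfolding M_def by (intro Max_in) auto
  then obtain j where j: "j \<le> t" "M = L (falling_poly j)" by auto
  have "L (falling_poly i) \<le> M" if "i \<le> t" for i
    unfolding M_def using that by (intro Max_ge) auto
  moreover have M: "0 \<le> M" using j(2) by (simp add: L_def nonneg)
  ultimately have LM: "L F \<le> M" for F
    unfolding L_def by (rule support_functional_le[OF t, rotated])
  have "M \<le> w (Polynomial.coeff (pcompose P [:x0, x0:]) j)"
    using of_nat_le_1[of "fact j"] nonneg unfolding j(2) L_def support_functional_falling mult
    by (intro mult_left_le_one_le)
  then show ?thesis
    using LM[of "falling_poly k" for k] unfolding L_def support_functional_falling
    by (intro roots_near_le[OF P x0 \<open>e + t < p\<close> j(1)]) (rule order_trans)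
qed

text \<open>
  A root \<open>x0\<close> at whose absolute value only the terms of degrees \<open>l\<close> and \<open>u\<close> are dominant behaves
  like a root of a binomial.  Let \<open>d\<close> be the \<open>p\<close>-adic absolute value of \<open>u - l\<close> and \<open>B\<close> the size
  of the dominant terms.  Because \<open>x0\<close> is a root, the functional does not change when the
  constant \<open>F(l)\<close> is subtracted from \<open>F\<close>; then all its values are at most \<open>B * d\<close>, since all
  exponents are congruent to \<open>l\<close> modulo the power of \<open>p\<close> in \<open>u - l\<close>.  For the first Taylor
  coefficient only the term of degree \<open>u\<close> has size \<open>B * d\<close>, so this bound is attained and
  \<open>roots_near_le\<close> applies with \<open>s = 1\<close>.
\<close>

lemma roots_near_le_1:
  assumes P: "P \<noteq> 0" and x0: "x0 \<noteq> 0" and e: "e + 1 < p" and root: "poly P x0 = 0"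
    and lu: "l \<in> support P" "u \<in> support P" "l < u"
    and eq: "w (Polynomial.coeff P l * x0 ^ l) = w (Polynomial.coeff P u * x0 ^ u)"
    and less: "\<And>i. i \<in> support P \<Longrightarrow> i \<noteq> l \<Longrightarrow> i \<noteq> u \<Longrightarrow>
        w (Polynomial.coeff P i * x0 ^ i) < w (Polynomial.coeff P u * x0 ^ u)"
    and dvd: "\<And>i. i \<in> support P \<Longrightarrow> int p ^ multiplicity p (u - l) dvd int i - int l"
  shows "roots_near P x0 \<le> 1"
proof -
  define b where "b i = Polynomial.coeff P i * x0 ^ i" for i
  define B where "B = w (b u)"
  define \<mu> where "\<mu> = multiplicity p (u - l)"
  define d where "d = (1 / real p) ^ \<mu>"
  have b_le: "w (b i) \<le> B" if "i \<in> support P" for i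
    using eq less[OF that] by (cases "i = l \<or> i = u") (auto simp: B_def b_def)
  have B: "0 < B" using lu(2) x0 unfolding B_def by (intro v_pos) (simp add: b_def support_def)
  have d: "0 < d" using p_gt_1 by (simp add: d_def)
  have wd: "w (of_int (int p ^ \<mu>)) = d"
    using p_gt_1 prime w_of_nat[of p] by (simp add: d_def power)
  have sum0: "(\<Sum>i\<in>support P. b i) = 0"
    using root by (simp add: poly_eq_sum_support b_def)
  have L: "support_functional P x0 F
      = (\<Sum>i\<in>support P. b i * of_int (poly F (int i) - poly F (int l)))" for F
  proof -
    have "(\<Sum>i\<in>support P. b i * of_int (poly F (int i) - poly F (int l)))
        = support_functional P x0 F - (\<Sum>i\<in>support P. b i) * of_int (poly F (int l))"
      by (simp add: support_functional_def b_def sum_subtractf sum_distrib_left sum_distrib_right algebra_simps)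
    then show ?thesis using sum0 by simp
  qed
  have diff: "w (of_int (poly F (int i) - poly F (int l))) \<le> d" if "i \<in> support P" for F i
  proof -
    have "int p ^ \<mu> dvd poly F (int i) - poly F (int l)"
      using dvd[OF that] unfolding \<mu>_def by (rule dvd_trans) (rule diff_dvd_poly_diff)
    then show ?thesis using of_int_dvd_le wd by metis
  qed
  have "w (support_functional P x0 F) \<le> B * d" for F
    unfolding L using b_le diff B d nonneg
    by (intro sum_le) (auto simp: mult intro!: mult_mono)
  then have le: "w (of_nat (fact k) * Polynomial.coeff (pcompose P [:x0, x0:]) k) \<le> B * d" for k
    by (simp only: support_functional_falling[symmetric])
  have linear: "support_functional P x0 (falling_poly 1) = (\<Sum>i\<in>support P. b i * of_int (int i - int l))"
    unfolding L by (simp add: falling_poly_def)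
  have wul: "w (b u * of_int (int u - int l)) = B * d"
    using lu(3) w_of_nat[of "u - l"] by (simp add: mult B_def d_def \<mu>_def of_nat_diff)
  have "w (\<Sum>i\<in>support P. b i * of_int (int i - int l)) = w (b u * of_int (int u - int l))"
  proof (rule sum_dominant)
    fix i assume i: "i \<in> support P" "i \<noteq> u"
    show "w (b i * of_int (int i - int l)) < w (b u * of_int (int u - int l))"
    proof (cases "i = l")
      case True
      then show ?thesis using wul B d by simp
    next
      case False
      have "w (b i) < B" using less[of i] i False by (simp add: b_def B_def)
      moreover have "w (of_int (int i - int l)) \<le> d" using diff[OF i(1), of "[:0, 1:]"] by simp
      ultimately show ?thesis
        unfolding wul unfolding mult
        using d nonneg by (intro le_less_trans[OF mult_left_mono mult_strict_right_mono])
    qed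
  qed (use lu in auto)
  then have "w (of_nat (fact 1) * Polynomial.coeff (pcompose P [:x0, x0:]) 1) = B * d"
    using wul unfolding support_functional_falling[symmetric] linear by simp
  then have one: "w (Polynomial.coeff (pcompose P [:x0, x0:]) 1) = B * d" by simp
  show ?thesis
    using le one by (intro roots_near_le[OF P x0 e, where j = 1]) (auto simp del: of_nat_fact)
qed

end


section \<open>Distribution of the roots over circles\<close>

lemma size_filter_proots:
  assumes "P \<noteq> 0"
  shows "size {#x \<in># proots P. R x#} = (\<Sum>x | poly P x = 0 \<and> R x. Polynomial.order x P)"
  using assms by (simp add: size_multiset_overloaded_eq)

context nonarch_absolute_value
begin

definition dominant_terms :: "'a poly \<Rightarrow> real \<Rightarrow> nat set" where
  "dominant_terms P r = {i \<in> support P. \<forall>k\<in>support P.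
     v (Polynomial.coeff P k) * r ^ k \<le> v (Polynomial.coeff P i) * r ^ i}"

lemma finite_dominant_terms: "finite (dominant_terms P r)"
  by (rule finite_subset[OF _ finite_support[of P]]) (auto simp: dominant_terms_def)

lemma dominant_terms_nonempty:
  assumes "P \<noteq> 0"
  shows "dominant_terms P r \<noteq> {}"
proof -
  define g where "g i = v (Polynomial.coeff P i) * r ^ i" for i
  have "support P \<noteq> {}" using assms by (auto simp: support_def poly_eq_iff)
  then have "Max (g ` support P) \<in> g ` support P" by (intro Max_in) auto
  then obtain i where i: "i \<in> support P" "g i = Max (g ` support P)" by auto
  have "g k \<le> g i" if "k \<in> support P" for k
    unfolding i(2) using that by (intro Max_ge) auto
  then show ?thesis using i(1) by (auto simp: dominant_terms_def g_def)
qed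

text \<open>
  Convexity of the Newton polygon: a larger radius favours higher degrees, so the sets of dominant
  exponents at two radii overlap at most in one point.
\<close>

lemma dominant_terms_mono:
  assumes r: "0 < r" "r < r'" and j: "j \<in> dominant_terms P r" and i: "i \<in> dominant_terms P r'"
  shows "j \<le> i"
proof (rule ccontr)
  assume "\<not> j \<le> i"
  then obtain d where d: "j = i + d" "0 < d" by (metis less_imp_add_positive not_le)
  define a where "a k = v (Polynomial.coeff P k)" for k
  have S: "i \<in> support P" "j \<in> support P" using i j by (auto simp: dominant_terms_def)
  then have pos: "0 < a j" by (auto simp: a_def support_def intro: v_pos)
  have "a i * r ^ i \<le> (a j * r ^ d) * r ^ i"
    using j S by (simp add: dominant_terms_def a_def d power_add mult_ac)
  then have "a i \<le> a j * r ^ d" using r by simp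
  also have "\<dots> < a j * r' ^ d" using r d pos by (simp add: power_strict_mono)
  finally have "a i * r' ^ i < a j * r' ^ j" using r by (simp add: d power_add mult_ac)
  moreover have "a j * r' ^ j \<le> a i * r' ^ i"
    using i S by (simp add: dominant_terms_def a_def)
  ultimately show False by simp
qed

text \<open>
  A single dominant term cannot be cancelled by the others.
\<close>

lemma root_imp_two_dominant_terms:
  assumes P: "P \<noteq> 0" and x: "poly P x = 0" "x \<noteq> 0"
  shows "Min (dominant_terms P (v x)) < Max (dominant_terms P (v x))"
proof (rule ccontr)
  define D where "D = dominant_terms P (v x)"
  have D: "finite D" "D \<noteq> {}"
    using finite_dominant_terms dominant_terms_nonempty[OF P] by (auto simp: D_def)
  assume "\<not> ?thesis"
  then have "Max D \<le> Min D" by (simp add: D_def)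
  define i where "i = Min D"
  have i: "i \<in> D" using D by (simp add: i_def)
  have uniq: "k = i" if "k \<in> D" for k
    using Min_le[OF D(1) that] Max_ge[OF D(1) that] \<open>Max D \<le> Min D\<close> by (simp add: i_def)
  define b where "b k = Polynomial.coeff P k * x ^ k" for k
  have vb: "v (b k) = v (Polynomial.coeff P k) * v x ^ k" for k
    by (simp add: b_def mult power)
  have iS: "i \<in> support P" using i by (simp add: D_def dominant_terms_def)
  have less: "v (b k) < v (b i)" if k: "k \<in> support P" "k \<noteq> i" for k
  proof (rule ccontr)
    assume "\<not> ?thesis"
    then have "k \<in> D"
      using i k by (auto simp: D_def dominant_terms_def vb)
    then show False using uniq k by blast
  qed
  have "v (poly P x) = v (b i)"
    unfolding poly_eq_sum_support b_def[symmetric]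
    using iS less by (intro sum_dominant) auto
  moreover have "b i \<noteq> 0" using iS x by (simp add: b_def support_def)
  ultimately show False using x by (simp add: eq_0_iff)
qed

end

text \<open>
  The residue field enters only through a map that separates its classes and takes at most
  \<open>q\<close> values on the valuation ring.
\<close>

locale ramified_field_finite_residue = ramified_field w p e \<rho>
  for w :: "'k::field \<Rightarrow> real" and p e :: nat and \<rho> :: real +
  fixes residue :: "'k \<Rightarrow> 'c" and q :: nat
  assumes residue_eq: "w x \<le> 1 \<Longrightarrow> w y \<le> 1 \<Longrightarrow> residue x = residue y \<Longrightarrow> w (x - y) < 1"
    and finite_residues: "finite (residue ` {x. w x \<le> 1})"
    and card_residues: "card (residue ` {x. w x \<le> 1}) \<le> q"
begin

text \<open>
  Dividing by one point of the circle turns the open discs of radius \<open>r\<close> on it into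
  distinct nonzero residue classes, of which there are at most \<open>q - 1\<close>.
\<close>

lemma sum_on_circle_le:
  assumes A: "finite A" "\<And>x. x \<in> A \<Longrightarrow> w x = r" and r: "0 < r"
    and le: "\<And>x0. x0 \<in> A \<Longrightarrow> (\<Sum>x\<in>{x \<in> A. w (x - x0) < r}. g x) \<le> (b :: nat)"
  shows "sum g A \<le> (q - 1) * b"
proof (cases "A = {}")
  case False
  then obtain x1 where x1: "x1 \<in> A" by blast
  have w1: "w x1 = r" "x1 \<noteq> 0" using A(2)[OF x1] r by auto
  define \<psi> where "\<psi> x = residue (x / x1)" for x
  have unit: "w (x / x1) = 1" if "x \<in> A" for x
    using A(2)[OF that] w1 r by (simp add: divide)
  have near: "w (x - y) < r" if "x \<in> A" "y \<in> A" "\<psi> x = \<psi> y" for x y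
  proof -
    have "w (x / x1 - y / x1) < 1"
      using that unit by (intro residue_eq) (auto simp: \<psi>_def)
    then show ?thesis
      using w1 r by (simp add: divide flip: diff_divide_distrib)
  qed
  have "\<psi> ` A \<subseteq> residue ` {x. w x \<le> 1} - {residue 0}"
  proof -
    have "\<psi> x \<noteq> residue 0" if "x \<in> A" for x
      using residue_eq[of "x / x1" 0] unit[OF that] by (auto simp: \<psi>_def)
    then show ?thesis using unit by (auto simp: \<psi>_def intro!: imageI)
  qed
  then have "card (\<psi> ` A) \<le> card (residue ` {x. w x \<le> 1} - {residue 0})"
    using finite_residues by (intro card_mono) auto
  also have "\<dots> \<le> q - 1"
    using card_residues finite_residues by (subst card_Diff_singleton) auto
  finally have card: "card (\<psi> ` A) \<le> q - 1" .
  have "sum g A = (\<Sum>c\<in>\<psi> ` A. sum g {x \<in> A. \<psi> x = c})"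
    using A(1) by (rule sum.image_gen)
  also have "\<dots> \<le> (\<Sum>c\<in>\<psi> ` A. b)"
  proof (intro sum_mono)
    fix c assume "c \<in> \<psi> ` A"
    then obtain x0 where x0: "x0 \<in> A" "c = \<psi> x0" by blast
    have "sum g {x \<in> A. \<psi> x = c} \<le> sum g {x \<in> A. w (x - x0) < r}"
      using A(1) near x0 by (intro sum_mono2) auto
    then show "sum g {x \<in> A. \<psi> x = c} \<le> b" using le[OF x0(1)] by simp
  qed
  also have "\<dots> \<le> (q - 1) * b" using card by simp
  finally show ?thesis .
qed simp

abbreviation roots_on_circle :: "'k poly \<Rightarrow> real \<Rightarrow> nat" where
  "roots_on_circle P r \<equiv> \<Sum>x | poly P x = 0 \<and> x \<noteq> 0 \<and> w x = r. Polynomial.order x P"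

lemma roots_on_circle_le:
  assumes P: "P \<noteq> 0" and r: "0 < r"
    and b: "\<And>x0. poly P x0 = 0 \<Longrightarrow> x0 \<noteq> 0 \<Longrightarrow> w x0 = r \<Longrightarrow> roots_near P x0 \<le> b"
  shows "roots_on_circle P r \<le> (q - 1) * b"
proof (rule sum_on_circle_le[OF _ _ r])
  have fin: "finite {x. poly P x = 0}" using P by (rule poly_roots_finite)
  then show "finite {x. poly P x = 0 \<and> x \<noteq> 0 \<and> w x = r}" by (rule rev_finite_subset) auto
  fix x0 assume x0: "x0 \<in> {x. poly P x = 0 \<and> x \<noteq> 0 \<and> w x = r}"
  have "(\<Sum>x\<in>{x \<in> {x. poly P x = 0 \<and> x \<noteq> 0 \<and> w x = r}. w (x - x0) < r}. Polynomial.order x P)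
      \<le> (\<Sum>x | poly P x = 0 \<and> w (x - x0) < w x0. Polynomial.order x P)"
    using x0 by (intro sum_mono2 finite_subset[OF _ fin]) auto
  also have "\<dots> \<le> b"
    using b[of x0] x0 size_filter_proots[OF P] by simp
  finally show "(\<Sum>x\<in>{x \<in> {x. poly P x = 0 \<and> x \<noteq> 0 \<and> w x = r}. w (x - x0) < r}. Polynomial.order x P) \<le> b" .
qed simp

text \<open>
  For each absolute value \<open>r\<close> of a nonzero root, the least and the largest dominant exponent
  \<open>I r < J r\<close> are distinct, and the intervals from \<open>I r\<close> to \<open>J r\<close> do not overlap.  Hence at most
  \<open>t\<close> values of \<open>r\<close> occur, and each circle carries at most \<open>(q - 1) * t\<close> roots.  If fewer than
  \<open>t\<close> circles occur this suffices.  If there are \<open>t\<close> of them, then \<open>J\<close> reaches every exponent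
  except the smallest one, so the intervals join consecutive exponents.  On a circle where \<open>p\<close>
  divides \<open>J r - I r\<close> least often, each residue class contains at most one root.
\<close>

theorem num_nonzero_roots_le:
  fixes P :: "'k poly"
  assumes P: "P \<noteq> 0" and t: "1 \<le> t" "e + t < p" "card (support P) \<le> Suc t"
  shows "size {#x \<in># proots P. x \<noteq> 0#} \<le> (t\<^sup>2 - t + 1) * (q - 1)"
proof -
  define S where "S = support P"
  define A where "A = {x. poly P x = 0 \<and> x \<noteq> 0}"
  define R where "R = w ` A"
  define D where "D = dominant_terms P"
  define I where "I r = Min (D r)" for r
  define J where "J r = Max (D r)" for r
  have D: "finite (D r)" "D r \<noteq> {}" for r
    using finite_dominant_terms dominant_terms_nonempty[OF P] by (auto simp: D_def)
  have IJ: "I r \<in> D r" "J r \<in> D r" for r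
    using D by (auto simp: I_def J_def)
  have DS: "D r \<subseteq> S" for r by (auto simp: D_def dominant_terms_def S_def)
  have finS: "finite S" by (simp add: S_def)
  have finA: "finite A" unfolding A_def using poly_roots_finite[OF P] by (rule rev_finite_subset) auto
  have Rpos: "0 < r" if "r \<in> R" for r using that v_pos by (auto simp: R_def A_def)
  have I_less_J: "I r < J r" if "r \<in> R" for r
    using that root_imp_two_dominant_terms[OF P] by (auto simp: R_def A_def I_def J_def D_def)
  have J_le_I: "J r \<le> I r'" if "r \<in> R" "r < r'" for r r'
    using IJ unfolding D_def by (intro dominant_terms_mono[OF Rpos[OF that(1)] that(2), of _ P])
  have J_less: "J r < J r'" if "r \<in> R" "r' \<in> R" "r < r'" for r r'
    using J_le_I[OF that(1,3)] I_less_J[OF that(2)] by simp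
  have J_inj: "inj_on J R"
    by (rule inj_onI) (metis J_less linorder_neq_iff)
  have min_le: "Min S \<le> i" if "i \<in> S" for i using finS that by simp
  have ISJ: "I r \<in> S" "J r \<in> S" for r using IJ DS by blast+
  have JR: "J ` R \<subseteq> S - {Min S}"
  proof -
    have "J r \<in> S - {Min S}" if "r \<in> R" for r
    proof -
      have "Min S < J r"
        using min_le[OF ISJ(1)] I_less_J[OF that] by (rule le_less_trans)
      then have "J r \<noteq> Min S" by (rule less_imp_neq[THEN not_sym])
      then show ?thesis using ISJ(2) by blast
    qed
    then show ?thesis by (rule image_subsetI)
  qed
  have "Min S \<in> S" using ISJ(1)[of 1] finS by (intro Min_in) auto
  then have cardS: "card (S - {Min S}) \<le> t"
    using t(3) finS by (subst card_Diff_singleton) (simp_all add: S_def)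
  have cardR: "card R \<le> t"
    using order_trans[OF card_inj_on_le[OF J_inj JR] cardS] finS by blast
  have each: "roots_on_circle P r \<le> (q - 1) * t" if "r \<in> R" for r
    using roots_near_le_num_monomials[OF P _ t(2,3)] Rpos[OF that]
    by (intro roots_on_circle_le[OF P]) auto
  have tt: "t\<^sup>2 - t = (t - 1) * t" by (simp add: power2_eq_square diff_mult_distrib)
  have "size {#x \<in># proots P. x \<noteq> 0#} = (\<Sum>x\<in>A. Polynomial.order x P)"
    unfolding A_def by (rule size_filter_proots[OF P])
  also have "\<dots> = (\<Sum>r\<in>R. roots_on_circle P r)"
    unfolding R_def by (subst sum.image_gen[OF finA, of _ w]) (simp add: A_def conj_assoc)
  also have "\<dots> \<le> (t\<^sup>2 - t + 1) * (q - 1)"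
  proof (cases "card R < t")
    case True
    have "(\<Sum>r\<in>R. roots_on_circle P r) \<le> card R * ((q - 1) * t)"
      using sum_bounded_above[of R "roots_on_circle P"] each by simp
    also have "\<dots> \<le> (t - 1) * ((q - 1) * t)" using True by (intro mult_right_mono) auto
    also have "\<dots> = (t\<^sup>2 - t) * (q - 1)" unfolding tt by (simp only: mult_ac)
    also have "\<dots> \<le> (t\<^sup>2 - t + 1) * (q - 1)" by (intro mult_right_mono) auto
    finally show ?thesis .
  next
    case False
    then have cR: "card R = t" using cardR by simp
    have finR: "finite R" using finA by (simp add: R_def)
    have "R \<noteq> {}" using cR t(1) by auto
    have JR_eq: "J ` R = S - {Min S}"
      using JR finS cardS card_image[OF J_inj] cR by (intro card_subset_eq) (auto intro: antisym card_mono)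
    \<comment> \<open>The exceptional circle is the one whose gap between dominant exponents has the least \<open>p\<close>-adic valuation.\<close>
    obtain r0 where r0: "r0 \<in> R"
      and r0_min: "\<And>r. r \<in> R \<Longrightarrow> multiplicity p (J r0 - I r0) \<le> multiplicity p (J r - I r)"
      using ex_is_arg_min_if_finite[OF finR \<open>R \<noteq> {}\<close>, of "\<lambda>r. multiplicity p (J r - I r)"]
      by (auto simp: is_arg_min_linorder)
    define \<mu> where "\<mu> = multiplicity p (J r0 - I r0)"
    \<comment> \<open>Every exponent is reached from the least one through the gaps, each divisible by \<open>p ^ \<mu>\<close>.\<close>
    have dvd_min: "int p ^ \<mu> dvd int i - int (Min S)" if "i \<in> S" for i
      using that
    proof (induction i rule: less_induct)
      case (less i)
      show ?case
      proof (cases "i = Min S")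
        case False
        then obtain r where r: "r \<in> R" "i = J r" using JR_eq less.prems by blast
        have "p ^ \<mu> dvd J r - I r"
          using r0_min[OF r(1)] unfolding \<mu>_def by (rule multiplicity_dvd')
        then have "int (p ^ \<mu>) dvd int (J r - I r)" by (simp only: of_nat_dvd_iff)
        then have "int p ^ \<mu> dvd int (J r) - int (I r)"
          using I_less_J[OF r(1)] by (simp add: of_nat_diff)
        moreover have "int p ^ \<mu> dvd int (I r) - int (Min S)"
          using I_less_J[OF r(1)] ISJ r by (intro less.IH) auto
        ultimately have "int p ^ \<mu> dvd (int (J r) - int (I r)) + (int (I r) - int (Min S))"
          by (rule dvd_add)
        then show ?thesis by (simp add: r)
      qed simp
    qed
    have dvd: "int p ^ \<mu> dvd int i - int (I r0)" if "i \<in> S" for i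
      using dvd_diff[OF dvd_min[OF that] dvd_min[OF ISJ(1)[of r0]]] by simp
    \<comment> \<open>A further dominant exponent would be the upper end \<open>J r\<close> for some circle, inside the gap at \<open>r0\<close>.\<close>
    have only_two: "i = I r0 \<or> i = J r0" if "i \<in> D r0" for i
    proof (rule ccontr)
      assume "\<not> ?thesis"
      moreover have "I r0 \<le> i" "i \<le> J r0" using that D by (auto simp: I_def J_def)
      ultimately have i: "I r0 < i" "i < J r0" by auto
      moreover have "i \<in> S - {Min S}"
        using that DS[of r0] min_le[OF ISJ(1)[of r0]] i(1) by (metis Diff_iff not_le singletonD subsetD)
      ultimately obtain r where r: "r \<in> R" "i = J r" using JR_eq by blast
      consider "r < r0" | "r = r0" | "r0 < r" by linarith
      then show False
        using J_le_I[of r r0] J_le_I[of r0 r] I_less_J[of r] r r0 i by cases auto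
    qed
    have "roots_near P x0 \<le> 1" if x0: "poly P x0 = 0" "x0 \<noteq> 0" "w x0 = r0" for x0
    proof (rule roots_near_le_1[OF P x0(2) _ x0(1), of "I r0" "J r0"])
      have wb: "w (Polynomial.coeff P i * x0 ^ i) = w (Polynomial.coeff P i) * r0 ^ i" for i
        by (simp add: mult power x0)
      show "e + 1 < p" using t by simp
      show "I r0 \<in> support P" "J r0 \<in> support P" using ISJ[of r0] by (simp_all add: S_def)
      show "I r0 < J r0" by (rule I_less_J[OF r0])
      show "w (Polynomial.coeff P (I r0) * x0 ^ I r0) = w (Polynomial.coeff P (J r0) * x0 ^ J r0)"
        using IJ[of r0] by (intro antisym) (auto simp: D_def dominant_terms_def wb)
      show "int p ^ multiplicity p (J r0 - I r0) dvd int i - int (I r0)" if "i \<in> support P" for i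
        using dvd[of i] that by (simp add: \<mu>_def S_def)
      fix i assume i: "i \<in> support P" "i \<noteq> I r0" "i \<noteq> J r0"
      then have "i \<notin> D r0" using only_two by blast
      then obtain k where "k \<in> support P"
        "w (Polynomial.coeff P i) * r0 ^ i < w (Polynomial.coeff P k) * r0 ^ k"
        using i by (auto simp: D_def dominant_terms_def not_le)
      moreover have "w (Polynomial.coeff P k) * r0 ^ k \<le> w (Polynomial.coeff P (J r0)) * r0 ^ J r0"
        if "k \<in> support P" for k
        using IJ[of r0] that by (auto simp: D_def dominant_terms_def)
      ultimately show "w (Polynomial.coeff P i * x0 ^ i) < w (Polynomial.coeff P (J r0) * x0 ^ J r0)"
        unfolding wb by force
    qed
    then have special: "roots_on_circle P r0 \<le> q - 1"
      using roots_on_circle_le[OF P Rpos[OF r0], of 1] by simp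
    have "(\<Sum>r\<in>R. roots_on_circle P r)
        = roots_on_circle P r0 + (\<Sum>r\<in>R - {r0}. roots_on_circle P r)"
      using finR r0 by (rule sum.remove)
    also have "(\<Sum>r\<in>R - {r0}. roots_on_circle P r) \<le> card (R - {r0}) * ((q - 1) * t)"
      using sum_bounded_above[of "R - {r0}" "roots_on_circle P"] each by simp
    also have "card (R - {r0}) = t - 1" using finR r0 cR by simp
    finally have "(\<Sum>r\<in>R. roots_on_circle P r) \<le> (q - 1) + (t - 1) * ((q - 1) * t)"
      using special by simp
    also have "\<dots> = (t\<^sup>2 - t + 1) * (q - 1)"
      unfolding tt by (simp only: add_mult_distrib add_mult_distrib2 mult_1 mult_1_right mult_ac add.commute)
    finally show ?thesis .
  qed
  finally show ?thesis .
qed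

end


section \<open>The p-adic numbers\<close>

lemma multiplicity_int: "multiplicity (int p) (int n) = multiplicity p n"
  unfolding multiplicity_def by (simp flip: of_nat_power)

context padic_numbers
begin

lemma v_of_nat:
  assumes "0 < n"
  shows "v (of_nat n) = (1 / real p) ^ multiplicity p n"
proof -
  have "quotient_of (of_nat n) = (int n, 1)"
    using quotient_of_int[of "int n"] by simp
  then have "padic_abs p (of_nat n) = real p powi (- int (multiplicity p n))"
    using assms by (simp add: padic_abs_def multiplicity_int)
  then show ?thesis
    using extends[of "of_nat n"] by (simp add: power_int_minus power_inverse divide_inverse)
qed

lemma p_gt_1: "1 < p"
  using prime prime_gt_1_nat by blast

lemma v_p: "v (of_nat p) = 1 / real p"
  using v_of_nat[of p] p_gt_1 prime by simp

lemma rational_approx: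
  assumes "0 < r"
  shows "\<exists>s. v (a - of_rat s) < r"
proof -
  interpret M: Metric_space UNIV "\<lambda>x y. v (x - y)" by (rule metric_space)
  have "a \<in> M.mtopology closure_of range of_rat" using dense by simp
  then show ?thesis using assms unfolding M.metric_closure_of M.mball_def by auto
qed

text \<open>
  A rational number closer to \<open>a\<close> than \<open>0\<close> is has the same absolute value.
\<close>

lemma v_eq_powi:
  assumes "a \<noteq> 0"
  shows "\<exists>k. v a = real p powi k"
proof -
  obtain s where s: "v (a - of_rat s) < v a" using rational_approx v_pos[OF assms] by blast
  then have "v (of_rat s) = v a"
    by (intro close_imp_eq) (simp add: v_diff_commute)
  moreover from this have "s \<noteq> 0" using v_pos[OF assms] by auto
  ultimately show ?thesis using extends[of s] unfolding padic_abs_def by metis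
qed

lemma p_dvd_imp_less_1: "int p dvd z \<Longrightarrow> v (of_int z) < 1"
  using of_int_dvd_le[of "int p" z] v_p p_gt_1 by (auto intro: le_less_trans)

text \<open>
  The residue field of the \<open>p\<close>-adic numbers has \<open>p\<close> elements: by density an integral element is
  congruent to a rational number, whose denominator is prime to \<open>p\<close> and hence invertible
  modulo \<open>p\<close>.
\<close>

lemma residue_representative:
  assumes "v a \<le> 1"
  shows "\<exists>n<p. v (a - of_nat n) < 1"
proof (cases "v a < 1")
  case True
  then show ?thesis using p_gt_1 by (intro exI[of _ 0]) auto
next
  case False
  then have va: "v a = 1" using assms by simp
  obtain s where s: "v (a - of_rat s) < 1" using rational_approx[of 1] by auto
  obtain x y where xy: "quotient_of s = (x, y)" by (cases "quotient_of s")
  have y: "0 < y" "coprime x y" using xy quotient_of_denom_pos quotient_of_coprime by blast+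
  have sxy: "of_rat s = (of_int x / of_int y :: 'q)"
    using quotient_of_div[OF xy] by (simp add: of_rat_divide)
  have vs: "v (of_rat s) = 1"
    using s va close_imp_eq[of "of_rat s" a] by (simp add: v_diff_commute)
  have "v (of_int x) = v (of_int y)"
    using vs y v_pos[of "of_int y"] by (simp add: sxy divide field_simps)
  then have x_y: "v (of_int x) < 1 \<longleftrightarrow> v (of_int y) < 1" by simp
  have p_dvd: "int p dvd z" if z: "z \<noteq> 0" "v (of_int z) < 1" for z
  proof (rule ccontr)
    assume "\<not> int p dvd z"
    then have "\<not> p dvd nat \<bar>z\<bar>" by (metis dvd_abs_iff int_dvd_int_iff int_nat_eq abs_ge_zero)
    then have "v (of_nat (nat \<bar>z\<bar>)) = 1"
      using z by (subst v_of_nat) (auto simp: not_dvd_imp_multiplicity_0)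
    moreover have "v (of_nat (nat \<bar>z\<bar>)) = v (of_int z)"
      using v_minus[of "of_int z"] by (cases "0 \<le> z") (simp_all add: of_nat_nat)
    ultimately show False using z(2) by (simp only: less_irrefl)
  qed
  have "x \<noteq> 0" using vs sxy by auto
  have ndvd: "\<not> int p dvd y"
  proof
    assume *: "int p dvd y"
    then have "int p dvd x" using x_y p_dvd_imp_less_1 p_dvd \<open>x \<noteq> 0\<close> by blast
    then show False using coprime_common_divisor[OF y(2) _ *] p_gt_1 by simp
  qed
  then have vy: "v (of_int y) = 1"
    using p_dvd[of y] y of_int_le_1[of y] by force
  have "coprime (int p) y"
    using prime ndvd by (intro prime_imp_coprime) auto
  then obtain u c where uc: "u * int p + c * y = 1"
    using bezout_int[of "int p" y] by auto
  define n where "n = nat (x * c mod int p)"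
  have n: "int n = x * c mod int p" using p_gt_1 by (simp add: n_def)
  have "n < p" using n p_gt_1 by (metis of_nat_0_less_iff of_nat_less_iff pos_mod_bound zero_less_one less_trans)
  have 1: "x - y * int n = int p * (x * u + y * (x * c div int p))"
  proof -
    have "int n = x * c - int p * (x * c div int p)" by (simp add: n minus_mult_div_eq_mod)
    then have "y * int n = y * (x * c - int p * (x * c div int p))" by simp
    also have "\<dots> = x * (c * y) - y * (int p * (x * c div int p))" by (simp only: algebra_simps)
    also have "c * y = 1 - u * int p" using uc by simp
    finally show ?thesis by (simp only: algebra_simps)
  qed
  have "v (of_int (x - y * int n)) < 1"
    by (rule p_dvd_imp_less_1) (simp add: 1)
  moreover have "of_rat s - of_nat n = (of_int (x - y * int n) / of_int y :: 'q)"
    using y by (simp add: sxy field_simps)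
  ultimately have "v (of_rat s - of_nat n) < 1" using vy by (simp add: divide)
  then have "v ((a - of_rat s) + (of_rat s - of_nat n)) < 1"
    using s by (intro le_less_trans[OF ultrametric]) simp
  then show ?thesis using \<open>n < p\<close> by auto
qed

end


section \<open>The value group of a finite extension\<close>

context finite_padic_extension
begin

lemma h_zero [simp]: "h 0 = 0"
  using hom_add[of 0 0] by (metis add_cancel_right_right add_0_left)

lemma h_of_nat: "h (of_nat n) = of_nat n"
  by (induction n) (simp_all add: hom_add hom_one)

lemma h_minus: "h (- a) = - h a"
  using hom_add[of a "- a"] by (simp add: eq_neg_iff_add_eq_0 add.commute)

lemma h_diff: "h (a - b) = h a - h b"
  using hom_add[of a "- b"] by (simp add: h_minus)

lemma h_eq_0_iff: "h a = 0 \<longleftrightarrow> a = 0"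
  using extends[of a] eq_0_iff[of "h a"] base.eq_0_iff[of a] by simp

text \<open>
  The form in which finite dimensionality is used below: it makes both the ramification index and
  the residue degree finite.  Their definitions give \<open>0\<close> or an unspecified value for an
  infinite index or degree, so finiteness has to be established first.
\<close>

lemma linearly_independent_bound:
  "\<exists>N. \<forall>T. (\<forall>t u. finite t \<longrightarrow> t \<subseteq> T \<longrightarrow> (\<Sum>x\<in>t. h (u x) * x) = 0 \<longrightarrow> (\<forall>x\<in>t. u x = 0))
        \<longrightarrow> finite T \<and> card T \<le> N"
proof -
  obtain B where "finite_dimensional_vector_space (\<lambda>a x. h a * x) B"
    using finite_dimensional by blast
  then interpret V: finite_dimensional_vector_space "\<lambda>a x. h a * x" B .
  show ?thesis
    using V.independent_span_bound[OF V.finite_Basis] V.span_Basis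
    by (intro exI[of _ "card B"]) (auto simp: V.independent_explicit_finite_subsets)
qed

abbreviation value_subgroup :: "real set" where
  "value_subgroup \<equiv> carrier (value_group v)"

lemma comm_group_value_group: "comm_group (value_group w)"
proof (rule comm_groupI)
  fix x assume "x \<in> carrier (value_group w)"
  then obtain a where "a \<noteq> 0" "x = w a" by (auto simp: value_group_def)
  then show "\<exists>y\<in>carrier (value_group w). y \<otimes>\<^bsub>value_group w\<^esub> x = \<one>\<^bsub>value_group w\<^esub>"
    by (intro bexI[of _ "w (1 / a)"]) (auto simp: value_group_def v_one simp flip: mult)
next
  show "\<one>\<^bsub>value_group w\<^esub> \<in> carrier (value_group w)"
    using v_one by (auto simp: value_group_def intro!: image_eqI[of _ _ 1])
next
  fix x y assume "x \<in> carrier (value_group w)" "y \<in> carrier (value_group w)"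
  then obtain a b where "a \<noteq> 0" "x = w a" "b \<noteq> 0" "y = w b" by (auto simp: value_group_def)
  then show "x \<otimes>\<^bsub>value_group w\<^esub> y \<in> carrier (value_group w)"
    by (auto simp: value_group_def simp flip: mult intro!: imageI)
qed (auto simp: value_group_def)

sublocale G: comm_group "value_group w"
  by (rule comm_group_value_group)

lemma value_group_simps:
  "carrier (value_group w) = w ` (- {0})"
  "x \<otimes>\<^bsub>value_group w\<^esub> y = x * y" "\<one>\<^bsub>value_group w\<^esub> = 1"
  "value_subgroup = v ` (- {0})"
  by (simp_all add: value_group_def)

lemma subgroup_value_subgroup: "subgroup value_subgroup (value_group w)"
proof (rule G.subgroupI)
  show "value_subgroup \<subseteq> carrier (value_group w)"
    by (force simp: value_group_simps h_eq_0_iff simp flip: extends)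
  show "value_subgroup \<noteq> {}" unfolding value_group_simps by (metis ComplI empty_iff image_eqI singletonD zero_neq_one)
  fix x assume "x \<in> value_subgroup"
  then obtain a where a: "a \<noteq> 0" "x = v a" by (auto simp: value_group_simps)
  have inverse: "x * v (1 / a) = 1"
    unfolding a(2) base.mult[symmetric] using a(1) by (simp add: base.v_one)
  have mem: "x \<in> value_subgroup" "v (1 / a) \<in> value_subgroup"
    using a unfolding value_group_simps by auto
  have "inv\<^bsub>value_group w\<^esub> x = v (1 / a)"
    by (intro G.inv_unique'[symmetric] subsetD[OF \<open>value_subgroup \<subseteq> carrier (value_group w)\<close>] mem)
       (simp_all only: value_group_simps(2,3) inverse mult.commute[of "v (1 / a)"])
  then show "inv\<^bsub>value_group w\<^esub> x \<in> value_subgroup" using a by (auto simp: value_group_simps)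
next
  fix x y assume "x \<in> value_subgroup" "y \<in> value_subgroup"
  then show "x \<otimes>\<^bsub>value_group w\<^esub> y \<in> value_subgroup"
    by (auto simp: value_group_simps simp flip: base.mult intro!: imageI)
qed

text \<open>
  In a nontrivial combination the nonzero terms have distinct absolute values, so one of them
  dominates.
\<close>

lemma distinct_values_independent:
  assumes fin: "finite t" and x: "x0 \<in> t" "u x0 \<noteq> 0"
    and nz: "\<And>x. x \<in> t \<Longrightarrow> x \<noteq> 0"
    and dist: "\<And>x y. x \<in> t \<Longrightarrow> y \<in> t \<Longrightarrow> u x \<noteq> 0 \<Longrightarrow> u y \<noteq> 0 \<Longrightarrow> w (h (u x) * x) = w (h (u y) * y) \<Longrightarrow> x = y"
  shows "(\<Sum>x\<in>t. h (u x) * x) \<noteq> 0"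
proof -
  define t' where "t' = {x \<in> t. u x \<noteq> 0}"
  define F where "F x = h (u x) * x" for x
  have t': "finite t'" "t' \<noteq> {}" using fin x by (auto simp: t'_def)
  obtain m where m: "m \<in> t'" "\<And>y. y \<in> t' \<Longrightarrow> w (F y) \<le> w (F m)"
    using ex_is_arg_min_if_finite[OF t', of "\<lambda>y. - w (F y)"] by (auto simp: is_arg_min_linorder)
  have "w (F y) < w (F m)" if "y \<in> t'" "y \<noteq> m" for y
    using m(2)[OF that(1)] dist[of y m] that m(1) by (auto simp: F_def t'_def less_le)
  then have "w (sum F t') = w (F m)"
    using t' m by (intro sum_dominant) auto
  moreover have "F m \<noteq> 0" using m(1) nz[of m] by (auto simp: F_def t'_def h_eq_0_iff)
  ultimately have "sum F t' \<noteq> 0" by (metis eq_0_iff)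
  moreover have "sum F t = sum F t'"
    using fin by (intro sum.mono_neutral_right) (auto simp: t'_def F_def)
  ultimately show ?thesis by (simp add: F_def)
qed

text \<open>
  Representatives of distinct cosets of the value group are linearly independent, because scalars
  change absolute values only within a coset.
\<close>

lemma finite_rcosets: "finite (rcosets\<^bsub>value_group w\<^esub> value_subgroup)"
proof -
  define c where "c x = value_subgroup #>\<^bsub>value_group w\<^esub> w x" for x
  define \<C> where "\<C> = rcosets\<^bsub>value_group w\<^esub> value_subgroup"
  define rep where "rep C = (SOME x. x \<noteq> 0 \<and> C = c x)" for C
  have rep: "rep C \<noteq> 0 \<and> C = c (rep C)" if C: "C \<in> \<C>" for C
  proof -
    obtain g where "g \<in> carrier (value_group w)" "C = value_subgroup #>\<^bsub>value_group w\<^esub> g"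
      using C unfolding \<C>_def RCOSETS_def by blast
    then have "\<exists>x. x \<noteq> 0 \<and> C = c x" unfolding value_group_simps(1) c_def by blast
    then show ?thesis unfolding rep_def by (rule someI_ex)
  qed
  have c_rep: "rep (c y) = y" if y: "y \<in> rep ` \<C>" for y
  proof -
    obtain C where C: "C \<in> \<C>" "y = rep C" using y by blast
    then have "c y = C" using rep[OF C(1)] by simp
    then show ?thesis using C(2) by simp
  qed
  have c_eq: "c x = c y" if "x \<noteq> 0" "y \<noteq> 0" "a \<noteq> 0" "b \<noteq> 0" "w (h a * x) = w (h b * y)" for x y a b
  proof -
    have "w x = v (b / a) * w y"
      using that base.v_pos[of a] by (simp add: mult extends base.divide field_simps)
    moreover have "v (b / a) \<in> value_subgroup" using that by (auto simp: value_group_simps)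
    ultimately have "w x \<in> c y" unfolding c_def r_coset_def value_group_simps(2) by blast
    then show ?thesis
      unfolding c_def using that
      by (intro G.repr_independence[symmetric] subgroup_value_subgroup) (auto simp: value_group_simps)
  qed
  obtain N where N: "\<And>T. (\<forall>t u. finite t \<longrightarrow> t \<subseteq> T \<longrightarrow> (\<Sum>x\<in>t. h (u x) * x) = 0 \<longrightarrow> (\<forall>x\<in>t. u x = 0))
        \<Longrightarrow> finite T \<and> card T \<le> N"
    using linearly_independent_bound by blast
  have "finite (rep ` \<C>)"
  proof (rule N[THEN conjunct1], intro allI impI ballI, rule ccontr)
    fix t u x assume t: "finite t" "t \<subseteq> rep ` \<C>" "(\<Sum>x\<in>t. h (u x) * x) = 0" "x \<in> t" "u x \<noteq> 0"
    have "(\<Sum>x\<in>t. h (u x) * x) \<noteq> 0"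
    proof (rule distinct_values_independent[of _ x])
      show nz: "y \<noteq> 0" if "y \<in> t" for y using that t(2) rep by auto
      fix y z assume "y \<in> t" "z \<in> t" "u y \<noteq> 0" "u z \<noteq> 0" "w (h (u y) * y) = w (h (u z) * z)"
      then show "y = z" using c_eq[of y z] nz c_rep t(2) by (metis subsetD)
    qed (use t in auto)
    then show False using t by simp
  qed
  moreover have "inj_on rep \<C>" by (rule inj_onI) (metis rep)
  ultimately show ?thesis unfolding \<C>_def by (rule finite_imageD)
qed

lemma ramification_index_pos: "0 < ramification_index v w"
proof -
  have "value_subgroup #>\<^bsub>value_group w\<^esub> 1 \<in> rcosets\<^bsub>value_group w\<^esub> value_subgroup"
    using G.one_closed unfolding RCOSETS_def value_group_simps(3) by blast
  then show ?thesis
    unfolding ramification_index_def using finite_rcosets by (auto simp: card_gt_0_iff)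
qed

text \<open>
  Lagrange's theorem in the quotient of the value groups.
\<close>

lemma power_ramification_index:
  assumes "x \<noteq> 0"
  shows "w x ^ ramification_index v w \<in> value_subgroup"
proof -
  define e where "e = ramification_index v w"
  interpret N: normal value_subgroup "value_group w"
    by (rule G.normal_iff_subgroup[THEN iffD2, OF subgroup_value_subgroup])
  have Q: "group (value_group w Mod value_subgroup)" by (rule N.factorgroup_is_group)
  have wx: "w x \<in> carrier (value_group w)" using assms by (simp add: value_group_simps)
  have pow: "w x [^]\<^bsub>value_group w\<^esub> n = w x ^ n" for n :: nat
    by (induction n) (simp_all add: value_group_simps)
  have "order (value_group w Mod value_subgroup) = e"
    by (simp add: order_def e_def ramification_index_def FactGroup_def)
  moreover have "value_subgroup #>\<^bsub>value_group w\<^esub> w x \<in> carrier (value_group w Mod value_subgroup)"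
    using wx by (auto simp: carrier_FactGroup)
  ultimately have "value_subgroup #>\<^bsub>value_group w\<^esub> (w x ^ e) = value_subgroup"
    using group.pow_order_eq_1[OF Q] N.FactGroup_pow[OF wx, of e] by (simp add: pow)
  moreover have "w x ^ e \<in> carrier (value_group w)"
    using assms by (auto simp: value_group_simps simp flip: power)
  ultimately show ?thesis
    using subgroup_value_subgroup G.rcos_self unfolding e_def by metis
qed

lemma w_of_nat: "0 < n \<Longrightarrow> w (of_nat n) = (1 / real p) ^ multiplicity p n"
  using base.v_of_nat[of n] extends[of "of_nat n"] by (simp add: h_of_nat)

text \<open>
  The power of exponent \<open>e\<close> of an absolute value below \<open>1\<close> is an integral power of \<open>p\<close> below
  \<open>1\<close>, hence at most \<open>1 / p\<close>.
\<close>

lemma less_1_imp_le_root: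
  assumes "w x < 1"
  shows "w x \<le> root (ramification_index v w) (1 / real p)"
proof (cases "x = 0")
  case True
  then show ?thesis by (simp add: real_root_ge_zero)
next
  case False
  define e where "e = ramification_index v w"
  have e: "0 < e" using ramification_index_pos by (simp add: e_def)
  have p: "1 < p" by (rule base.p_gt_1)
  obtain a where "a \<noteq> 0" "w x ^ e = v a"
    using power_ramification_index[OF False] by (auto simp: value_group_simps e_def)
  then obtain k where k: "w x ^ e = real p powi k" using base.v_eq_powi by metis
  have "real p powi k < real p powi 0"
    using power_Suc_less_one[of "w x" "e - 1"] assms v_pos[OF False] e by (simp flip: k)
  then have "k < 0" using p by (metis power_int_increasing not_less of_nat_1 of_nat_le_iff less_imp_le)
  then have "real p powi k \<le> real p powi (- 1)" using p by (intro power_int_increasing) auto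
  then have "w x ^ e \<le> root e (1 / real p) ^ e"
    using e by (simp add: k power_int_minus divide_inverse)
  then show ?thesis
    unfolding e_def[symmetric] using e by (subst (asm) power_mono_iff) (auto simp: nonneg)
qed

end


section \<open>The residue field of a finite extension\<close>

context nonarch_absolute_value
begin

abbreviation residue_class :: "'a \<Rightarrow> 'a set" where
  "residue_class x \<equiv> valuation_ideal v +>\<^bsub>valuation_ring v\<^esub> x"

lemma valuation_ring_simps:
  "carrier (valuation_ring v) = {x. v x \<le> 1}"
  "x \<otimes>\<^bsub>valuation_ring v\<^esub> y = x * y" "x \<oplus>\<^bsub>valuation_ring v\<^esub> y = x + y"
  "\<one>\<^bsub>valuation_ring v\<^esub> = 1" "\<zero>\<^bsub>valuation_ring v\<^esub> = 0"
  by (simp_all add: valuation_ring_def)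

lemma mult_le_1: "v x \<le> 1 \<Longrightarrow> v y \<le> 1 \<Longrightarrow> v (x * y) \<le> 1"
  using nonneg by (simp add: mult mult_le_one)

lemma add_le_1: "v x \<le> 1 \<Longrightarrow> v y \<le> 1 \<Longrightarrow> v (x + y) \<le> 1"
  using ultrametric[of x y] by (rule order_trans) simp

lemma add_less_1: "v x < 1 \<Longrightarrow> v y < 1 \<Longrightarrow> v (x + y) < 1"
  using ultrametric[of x y] by (rule le_less_trans) simp

lemma mult_less_1:
  assumes "v x \<le> 1" "v y < 1"
  shows "v (x * y) < 1"
proof -
  have "v x * v y \<le> 1 * v y" using assms(1) nonneg by (rule mult_right_mono)
  then show ?thesis using assms(2) by (simp add: mult)
qed

lemma cring_valuation_ring: "cring (valuation_ring v)"
proof (rule cringI)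
  show "abelian_group (valuation_ring v)"
  proof (rule abelian_groupI)
    fix x assume "x \<in> carrier (valuation_ring v)"
    then show "\<exists>y\<in>carrier (valuation_ring v). y \<oplus>\<^bsub>valuation_ring v\<^esub> x = \<zero>\<^bsub>valuation_ring v\<^esub>"
      by (intro bexI[of _ "- x"]) (simp_all add: valuation_ring_simps v_minus)
  qed (simp_all add: valuation_ring_simps add_le_1 add_ac)
  show "Group.comm_monoid (valuation_ring v)"
    by (rule comm_monoidI) (simp_all add: valuation_ring_simps mult_le_1 v_one mult_ac)
qed (simp add: valuation_ring_simps algebra_simps)

lemma ideal_valuation_ideal: "ideal (valuation_ideal v) (valuation_ring v)"
proof (rule idealI)
  interpret R: cring "valuation_ring v" by (rule cring_valuation_ring)
  show "ring (valuation_ring v)" by (rule R.ring_axioms)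
  show "subgroup (valuation_ideal v) (add_monoid (valuation_ring v))"
  proof (rule group.subgroupI[OF R.a_group])
    fix x assume x: "x \<in> valuation_ideal v"
    have "- x = inv\<^bsub>add_monoid (valuation_ring v)\<^esub> x"
      using x
      by (intro monoid.inv_unique'[OF group.is_monoid[OF R.a_group]])
         (simp_all add: valuation_ring_simps valuation_ideal_def v_minus)
    moreover have "- x \<in> valuation_ideal v" using x by (simp add: valuation_ideal_def v_minus)
    ultimately show "inv\<^bsub>add_monoid (valuation_ring v)\<^esub> x \<in> valuation_ideal v" by simp
  next
    show "valuation_ideal v \<noteq> {}"
      unfolding valuation_ideal_def using v_zero by (metis (mono_tags) empty_iff mem_Collect_eq zero_less_one)
  qed (auto simp: valuation_ring_simps valuation_ideal_def add_less_1)
next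
  fix a x assume "a \<in> valuation_ideal v" "x \<in> carrier (valuation_ring v)"
  then have "v (x * a) < 1"
    by (intro mult_less_1) (simp_all add: valuation_ring_simps valuation_ideal_def)
  then show "x \<otimes>\<^bsub>valuation_ring v\<^esub> a \<in> valuation_ideal v"
    and "a \<otimes>\<^bsub>valuation_ring v\<^esub> x \<in> valuation_ideal v"
    by (simp_all add: valuation_ring_simps valuation_ideal_def mult.commute)
qed

lemma residue_class_eq_ball: "residue_class x = {z. v (z - x) < 1}"
  unfolding a_r_coset_def' valuation_ideal_def valuation_ring_simps
  by (auto intro!: exI[of _ "z - x" for z])

lemma residue_class_eq_iff: "residue_class x = residue_class y \<longleftrightarrow> v (x - y) < 1"
proof
  assume eq: "residue_class x = residue_class y"
  have "x \<in> residue_class x" by (simp add: residue_class_eq_ball)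
  then have "x \<in> residue_class y" by (simp only: eq)
  then show "v (x - y) < 1" by (simp add: residue_class_eq_ball)
next
  assume *: "v (x - y) < 1"
  have "v (z - x) < 1 \<longleftrightarrow> v (z - y) < 1" for z
    using add_less_1[of "z - x" "x - y"] add_less_1[of "z - y" "y - x"] * v_diff_commute[of x y] by auto
  then show "residue_class x = residue_class y" by (simp add: residue_class_eq_ball)
qed

lemma residue_class_hom: "residue_class \<in> ring_hom (valuation_ring v) (residue_field v)"
  unfolding residue_field_def by (rule ideal.rcos_ring_hom[OF ideal_valuation_ideal])

lemma residue_field_simps:
  shows carrier_residue_field: "carrier (residue_field v) = residue_class ` {x. v x \<le> 1}"
    and residue_class_mult: "v x \<le> 1 \<Longrightarrow> v y \<le> 1 \<Longrightarrow>
      residue_class x \<otimes>\<^bsub>residue_field v\<^esub> residue_class y = residue_class (x * y)"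
    and residue_class_add: "v x \<le> 1 \<Longrightarrow> v y \<le> 1 \<Longrightarrow>
      residue_class x \<oplus>\<^bsub>residue_field v\<^esub> residue_class y = residue_class (x + y)"
    and residue_class_one: "\<one>\<^bsub>residue_field v\<^esub> = residue_class 1"
    and residue_class_zero: "\<zero>\<^bsub>residue_field v\<^esub> = residue_class 0"
proof -
  show "carrier (residue_field v) = residue_class ` {x. v x \<le> 1}"
    unfolding residue_field_def FactRing_def A_RCOSETS_def' valuation_ring_simps by auto
  show "v x \<le> 1 \<Longrightarrow> v y \<le> 1 \<Longrightarrow>
      residue_class x \<otimes>\<^bsub>residue_field v\<^esub> residue_class y = residue_class (x * y)"
    using ring_hom_mult[OF residue_class_hom, of x y] by (simp add: valuation_ring_simps)
  show "v x \<le> 1 \<Longrightarrow> v y \<le> 1 \<Longrightarrow>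
      residue_class x \<oplus>\<^bsub>residue_field v\<^esub> residue_class y = residue_class (x + y)"
    using ring_hom_add[OF residue_class_hom, of x y] by (simp add: valuation_ring_simps)
  show "\<one>\<^bsub>residue_field v\<^esub> = residue_class 1"
    using ring_hom_one[OF residue_class_hom] by (simp add: valuation_ring_simps)
  have "\<zero>\<^bsub>residue_field v\<^esub> = valuation_ideal v" by (simp add: residue_field_def FactRing_def)
  also have "\<dots> = residue_class 0" unfolding residue_class_eq_ball by (simp add: valuation_ideal_def)
  finally show "\<zero>\<^bsub>residue_field v\<^esub> = residue_class 0" .
qed

lemma field_residue_field: "field (residue_field v)"
proof (rule cring.cring_fieldI2)
  show "cring (residue_field v)"
    unfolding residue_field_def by (rule ideal.quotient_is_cring[OF ideal_valuation_ideal cring_valuation_ring])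
  show "\<zero>\<^bsub>residue_field v\<^esub> \<noteq> \<one>\<^bsub>residue_field v\<^esub>"
    unfolding residue_class_one residue_class_zero residue_class_eq_iff by (simp add: v_minus v_one)
  fix a assume a: "a \<in> carrier (residue_field v)" "a \<noteq> \<zero>\<^bsub>residue_field v\<^esub>"
  then obtain x where x: "v x \<le> 1" "a = residue_class x" by (auto simp: carrier_residue_field)
  then have vx: "v x = 1" using a(2) by (simp add: residue_class_zero residue_class_eq_iff)
  then have v1: "v (1 / x) = 1" by (simp add: divide v_one)
  have "a \<otimes>\<^bsub>residue_field v\<^esub> residue_class (1 / x) = \<one>\<^bsub>residue_field v\<^esub>"
  proof -
    have "a \<otimes>\<^bsub>residue_field v\<^esub> residue_class (1 / x) = residue_class (x * (1 / x))"
      unfolding x(2) using vx v1 by (intro residue_class_mult) simp_all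
    also have "x * (1 / x) = 1" using vx by auto
    finally show ?thesis by (simp add: residue_class_one)
  qed
  then show "\<exists>b\<in>carrier (residue_field v). a \<otimes>\<^bsub>residue_field v\<^esub> b = \<one>\<^bsub>residue_field v\<^esub>"
    using v1 by (intro bexI[of _ "residue_class (1 / x)"]) (simp_all add: carrier_residue_field)
qed

end

context finite_padic_extension
begin

abbreviation base_residues :: "'k set set" where
  "base_residues \<equiv> (\<lambda>a. residue_class (h a)) ` carrier (valuation_ring v)"

interpretation F: field "residue_field w"
  by (rule field_residue_field)

lemma mem_base_residues: "c \<in> base_residues \<longleftrightarrow> (\<exists>a. v a \<le> 1 \<and> c = residue_class (h a))"
  by (auto simp: base.valuation_ring_simps)

lemma base_residuesI: "v a \<le> 1 \<Longrightarrow> residue_class (h a) \<in> base_residues"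
  by (auto simp: mem_base_residues)

lemma subfield_base_residues: "subfield base_residues (residue_field w)"
proof (rule F.subfieldI')
  show "subring base_residues (residue_field w)"
  proof (rule F.subringI)
    show "base_residues \<subseteq> carrier (residue_field w)"
      unfolding carrier_residue_field base.valuation_ring_simps by (auto simp: extends)
    show "\<one>\<^bsub>residue_field w\<^esub> \<in> base_residues"
      using base_residuesI[of 1] by (simp add: residue_class_one hom_one base.v_one)
  next
    fix c assume "c \<in> base_residues"
    then obtain a where a: "v a \<le> 1" "c = residue_class (h a)" unfolding mem_base_residues by blast
    have "residue_class (h (- a)) \<oplus>\<^bsub>residue_field w\<^esub> c = residue_class (h (- a) + h a)"
      unfolding a(2) using a(1) by (intro residue_class_add) (simp_all add: extends base.v_minus)
    also have "\<dots> = \<zero>\<^bsub>residue_field w\<^esub>" by (simp add: h_minus residue_class_zero)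
    finally have "residue_class (h (- a)) \<oplus>\<^bsub>residue_field w\<^esub> c = \<zero>\<^bsub>residue_field w\<^esub>" .
    then have "\<ominus>\<^bsub>residue_field w\<^esub> c = residue_class (h (- a))"
      using a by (intro F.minus_equality) (simp_all add: carrier_residue_field extends base.v_minus)
    then show "\<ominus>\<^bsub>residue_field w\<^esub> c \<in> base_residues"
      using base_residuesI[of "- a"] a(1) by (simp add: base.v_minus)
  next
    fix c d assume "c \<in> base_residues" "d \<in> base_residues"
    then obtain a b where a: "v a \<le> 1" "c = residue_class (h a)" and b: "v b \<le> 1" "d = residue_class (h b)"
      unfolding mem_base_residues by blast
    have "c \<otimes>\<^bsub>residue_field w\<^esub> d = residue_class (h (a * b))"
      unfolding a(2) b(2) hom_mult using a(1) b(1) by (intro residue_class_mult) (simp_all add: extends)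
    then show "c \<otimes>\<^bsub>residue_field w\<^esub> d \<in> base_residues"
      using base_residuesI[OF base.mult_le_1[OF a(1) b(1)]] by simp
    have "c \<oplus>\<^bsub>residue_field w\<^esub> d = residue_class (h (a + b))"
      unfolding a(2) b(2) hom_add using a(1) b(1) by (intro residue_class_add) (simp_all add: extends)
    then show "c \<oplus>\<^bsub>residue_field w\<^esub> d \<in> base_residues"
      using base_residuesI[OF base.add_le_1[OF a(1) b(1)]] by simp
  qed
next
  fix c assume c: "c \<in> base_residues - {\<zero>\<^bsub>residue_field w\<^esub>}"
  then obtain a where a: "v a \<le> 1" "c = residue_class (h a)"
    unfolding mem_base_residues Diff_iff by blast
  have "\<not> w (h a - 0) < 1"
    using c unfolding a(2) residue_class_zero by (auto simp: residue_class_eq_iff)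
  then have va: "v a = 1" using a(1) by (simp add: extends)
  then have v1: "v (1 / a) = 1" by (simp add: base.divide base.v_one)
  have "c \<otimes>\<^bsub>residue_field w\<^esub> residue_class (h (1 / a)) = residue_class (h a * h (1 / a))"
    unfolding a(2) using va v1 by (intro residue_class_mult) (simp_all add: extends)
  also have "h a * h (1 / a) = h (a * (1 / a))" by (simp only: hom_mult)
  also have "a * (1 / a) = 1" using va by auto
  finally have *: "c \<otimes>\<^bsub>residue_field w\<^esub> residue_class (h (1 / a)) = \<one>\<^bsub>residue_field w\<^esub>"
    by (simp add: hom_one residue_class_one)
  have carr: "c \<in> carrier (residue_field w)" "residue_class (h (1 / a)) \<in> carrier (residue_field w)"
    unfolding carrier_residue_field a(2) using va v1 by (auto simp: extends)
  have "residue_class (h (1 / a)) = inv\<^bsub>residue_field w\<^esub> c"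
    using * F.m_comm[OF carr] by (intro F.inv_unique' carr) simp_all
  then show "inv\<^bsub>residue_field w\<^esub> c \<in> base_residues"
    using base_residuesI[of "1 / a"] v1 by simp
qed

lemma base_residues_subset: "base_residues \<subseteq> (\<lambda>n. residue_class (of_nat n)) ` {..<p}"
proof
  fix c assume "c \<in> base_residues"
  then obtain a where a: "v a \<le> 1" "c = residue_class (h a)" unfolding mem_base_residues by blast
  obtain n where n: "n < p" "v (a - of_nat n) < 1" using base.residue_representative[OF a(1)] by blast
  have "w (h a - of_nat n) < 1" using n(2) extends[of "a - of_nat n"] by (simp add: h_diff h_of_nat)
  then have "c = residue_class (of_nat n)" unfolding a(2) residue_class_eq_iff .
  then show "c \<in> (\<lambda>n. residue_class (of_nat n)) ` {..<p}" using n(1) by blast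
qed

lemma finite_base_residues: "finite base_residues"
  by (rule finite_subset[OF base_residues_subset]) simp

lemma card_base_residues: "card base_residues \<le> p"
  using card_mono[OF _ base_residues_subset] card_image_le[of "{..<p}" "\<lambda>n. residue_class (of_nat n)"]
  by simp

text \<open>
  The residue class of a linear combination is the corresponding combination of residue classes;
  \<open>r\<close> chooses a representative of each class.
\<close>

lemma residue_class_sum_list:
  assumes "\<And>U. U \<in> set Us \<Longrightarrow> w (r U) \<le> 1 \<and> residue_class (r U) = U"
    and "\<And>U. U \<in> set Us \<Longrightarrow> w (c U) \<le> 1"
  shows "w (\<Sum>U\<leftarrow>Us. c U * r U) \<le> 1 \<and>
     F.combine (map (\<lambda>U. residue_class (c U)) Us) Us = residue_class (\<Sum>U\<leftarrow>Us. c U * r U)"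
  using assms
proof (induction Us)
  case Nil
  then show ?case by (simp add: residue_class_zero)
next
  case (Cons U Us)
  have IH: "w (\<Sum>U\<leftarrow>Us. c U * r U) \<le> 1"
    "F.combine (map (\<lambda>U. residue_class (c U)) Us) Us = residue_class (\<Sum>U\<leftarrow>Us. c U * r U)"
    using Cons.IH Cons.prems by simp_all
  have U: "w (r U) \<le> 1" "residue_class (r U) = U" "w (c U) \<le> 1" using Cons.prems by simp_all
  have "residue_class (c U) \<otimes>\<^bsub>residue_field w\<^esub> U = residue_class (c U * r U)"
    using residue_class_mult[OF U(3,1)] by (simp only: U(2))
  then show ?case
    using IH U residue_class_add[OF mult_le_1[OF U(3,1)] IH(1)] add_le_1[OF mult_le_1[OF U(3,1)] IH(1)]
    by simp
qed

text \<open>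
  Lifts of linearly independent residue classes are linearly independent: a relation can be scaled
  so that its largest coefficient is \<open>1\<close>, and then it reduces to a nontrivial relation between
  the residue classes.
\<close>

lemma independent_residues_bound:
  "\<exists>N. \<forall>Us. F.independent base_residues Us \<longrightarrow> length Us \<le> N"
proof -
  define r where "r U = (SOME x. w x \<le> 1 \<and> residue_class x = U)" for U
  obtain N where N: "\<And>T. (\<forall>t u. finite t \<longrightarrow> t \<subseteq> T \<longrightarrow> (\<Sum>x\<in>t. h (u x) * x) = 0 \<longrightarrow> (\<forall>x\<in>t. u x = 0))
        \<Longrightarrow> finite T \<and> card T \<le> N"
    using linearly_independent_bound by blast
  have "length Us \<le> N" if ind: "F.independent base_residues Us" for Us
  proof -
    have r: "w (r U) \<le> 1 \<and> residue_class (r U) = U" if U: "U \<in> set Us" for U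
    proof -
      have "\<exists>x. w x \<le> 1 \<and> residue_class x = U"
        using F.independent_in_carrier[OF ind] U unfolding carrier_residue_field by blast
      then show ?thesis unfolding r_def by (rule someI_ex)
    qed
    have inj: "inj_on r (set Us)" by (rule inj_onI) (metis r)
    have dist: "distinct Us" using F.independent_distinct[OF subfield_base_residues ind] .
    have "card (r ` set Us) \<le> N"
    proof (rule N[THEN conjunct2], intro allI impI ballI, rule ccontr)
      fix t u x assume t: "finite t" "t \<subseteq> r ` set Us" "(\<Sum>x\<in>t. h (u x) * x) = 0" "x \<in> t" "u x \<noteq> 0"
      obtain m where m: "m \<in> t" "\<And>y. y \<in> t \<Longrightarrow> v (u y) \<le> v (u m)"
        using ex_is_arg_min_if_finite[of t "\<lambda>y. - v (u y)"] t by (auto simp: is_arg_min_linorder)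
      have vm: "0 < v (u m)" using m(2)[OF t(4)] base.v_pos[OF t(5)] by simp
      then have um: "u m \<noteq> 0" by auto
      \<comment> \<open>Scaling by the largest coefficient makes all coefficients integral and one of them \<open>1\<close>.\<close>
      define a where "a y = (if y \<in> t then u y / u m else 0)" for y
      have va: "v (a y) \<le> 1" for y
        using m(2)[of y] vm by (simp add: a_def base.divide)
      have am: "a m = 1" using m(1) um by (simp add: a_def)
      have "(\<Sum>U\<leftarrow>Us. h (a (r U)) * r U) = (\<Sum>U\<in>set Us. h (a (r U)) * r U)"
        by (rule sum_list_distinct_conv_sum_set[OF dist])
      also have "\<dots> = (\<Sum>y\<in>r ` set Us. h (a y) * y)"
        by (subst sum.reindex[OF inj]) simp
      also have "\<dots> = (\<Sum>y\<in>t. h (a y) * y)"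
        using t(2) by (intro sum.mono_neutral_right) (auto simp: a_def)
      also have "\<dots> = (\<Sum>y\<in>t. h (1 / u m) * (h (u y) * y))"
        by (intro sum.cong) (simp_all add: a_def flip: hom_mult mult.assoc)
      also have "\<dots> = h (1 / u m) * (\<Sum>y\<in>t. h (u y) * y)" by (rule sum_distrib_left[symmetric])
      finally have sum0: "(\<Sum>U\<leftarrow>Us. h (a (r U)) * r U) = 0" using t(3) by simp
      define Ks where "Ks = map (\<lambda>U. residue_class (h (a (r U)))) Us"
      have "F.combine Ks Us = residue_class (\<Sum>U\<leftarrow>Us. h (a (r U)) * r U)"
        unfolding Ks_def using residue_class_sum_list[of Us r "\<lambda>U. h (a (r U))"] r va
        by (simp add: extends)
      then have "F.combine Ks Us = \<zero>\<^bsub>residue_field w\<^esub>"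
        by (simp only: sum0 residue_class_zero)
      moreover have "set Ks \<subseteq> base_residues"
        using base_residuesI[OF va] by (auto simp: Ks_def)
      ultimately have "set (take (length Us) Ks) \<subseteq> {\<zero>\<^bsub>residue_field w\<^esub>}"
        by (intro F.independent_imp_trivial_combine[OF subfield_base_residues ind])
      then have zero: "set Ks \<subseteq> {\<zero>\<^bsub>residue_field w\<^esub>}" by (simp add: Ks_def)
      obtain U where U: "U \<in> set Us" "m = r U" using m(1) t(2) by blast
      have "residue_class (h (a (r U))) \<in> set Ks" using U(1) by (simp add: Ks_def)
      then have "\<one>\<^bsub>residue_field w\<^esub> \<in> set Ks" using am by (simp add: U(2) hom_one residue_class_one)
      then show False using zero F.one_not_zero by blast
    qed
    then show ?thesis using card_image[OF inj] distinct_card[OF dist] by simp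
  qed
  then show ?thesis by blast
qed

text \<open>
  Independent lists have bounded length, so one of maximal length is a basis, and its length is the
  residue degree.  Every residue class is then a combination with at most \<open>p\<close> choices for each
  coefficient.
\<close>

lemma finite_residue_field:
  "finite (carrier (residue_field w)) \<and> card (carrier (residue_field w)) \<le> p ^ residue_degree v h w"
proof -
  obtain N where N: "\<And>Us. F.independent base_residues Us \<Longrightarrow> length Us \<le> N"
    using independent_residues_bound by blast
  define L where "L = {n. \<exists>Us. F.independent base_residues Us \<and> length Us = n}"
  have L: "finite L" "0 \<in> L"
    using N finite_subset[of L "{..N}"] by (auto simp: L_def)
  then have "Max L \<in> L" by (intro Max_in) auto
  then obtain Us where Us: "F.independent base_residues Us" "length Us = Max L"
    by (auto simp: L_def)
  have span: "F.Span base_residues Us = carrier (residue_field w)"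
  proof (rule ccontr)
    assume "\<not> ?thesis"
    moreover have "F.Span base_residues Us \<subseteq> carrier (residue_field w)"
      by (rule F.Span_in_carrier[OF subfieldE(3)[OF subfield_base_residues] F.independent_in_carrier[OF Us(1)]])
    ultimately obtain u where "u \<in> carrier (residue_field w)" "u \<notin> F.Span base_residues Us" by blast
    then have "F.independent base_residues (u # Us)" using Us(1) by (rule F.li_Cons)
    then have "length (u # Us) \<in> L" unfolding L_def by blast
    then have "Suc (Max L) \<in> L" using Us(2) by simp
    then show False using Max_ge[OF L(1)] by fastforce
  qed
  have "F.dim base_residues (carrier (residue_field w)) = length Us"
    using F.dimI[OF subfield_base_residues, of "length Us" "carrier (residue_field w)"]
      F.dimension_independent[OF Us(1)] span by (simp add: over_def)
  then have f: "residue_degree v h w = length Us" by (simp add: residue_degree_def)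
  define KL where "KL = {Ks. set Ks \<subseteq> base_residues \<and> length Ks = length Us}"
  have KL: "finite KL" "card KL = card base_residues ^ length Us"
    unfolding KL_def by (rule finite_lists_length_eq card_lists_length_eq, rule finite_base_residues)+
  have eq: "carrier (residue_field w) = (\<lambda>Ks. F.combine Ks Us) ` KL"
    using F.Span_eq_combine_set_length_version[OF subfield_base_residues F.independent_in_carrier[OF Us(1)]]
    unfolding span KL_def by auto
  have "card (carrier (residue_field w)) \<le> card KL"
    unfolding eq by (rule card_image_le[OF KL(1)])
  also have "\<dots> \<le> p ^ length Us" unfolding KL(2) using card_base_residues by (rule power_mono) simp
  finally show ?thesis using KL(1) by (simp add: f) (simp add: eq)
qed

lemma ramified_field_finite_residue:
  "ramified_field_finite_residue w p (ramification_index v w)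
     (root (ramification_index v w) (1 / real p)) residue_class (p ^ residue_degree v h w)"
proof unfold_locales
  have p: "1 < p" by (rule base.p_gt_1)
  show "prime p" by (rule base.prime)
  show "0 < root (ramification_index v w) (1 / real p)"
    using ramification_index_pos p by simp
  show "root (ramification_index v w) (1 / real p) < 1"
    using ramification_index_pos p by simp
  show "root (ramification_index v w) (1 / real p) ^ ramification_index v w = 1 / real p"
    using ramification_index_pos p by (intro real_root_pow_pos) simp_all
  show "finite (residue_class ` {x. w x \<le> 1})"
    "card (residue_class ` {x. w x \<le> 1}) \<le> p ^ residue_degree v h w"
    using finite_residue_field by (simp_all add: carrier_residue_field)
qed (simp_all add: w_of_nat less_1_imp_le_root residue_class_eq_iff)

end


section \<open>The bound for finite extensions of the p-adic numbers\<close>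

theorem theorem1p4:
  fixes p e f t :: nat
    and v :: "'q::field_char_0 \<Rightarrow> real"
    and h :: "'q \<Rightarrow> 'k::field"
    and w :: "'k \<Rightarrow> real"
  assumes "prime p"
    and "finite_padic_extension p v h w"
    and "e = ramification_index v w"
    and "f = residue_degree v h w"
    and "t \<ge> 1"
    and "p > e + t"
  shows "B_m t TYPE('k) \<le> enat ((t\<^sup>2 - t + 1) * (p ^ f - 1))"
proof -
  interpret finite_padic_extension p v h w by fact
  interpret ramified_field_finite_residue w p e "root e (1 / real p)" residue_class "p ^ f"
    unfolding assms(3,4) by (rule ramified_field_finite_residue)
  show ?thesis
    unfolding B_m_def
  proof (rule SUP_least)
    fix P :: "'k poly" assume "P \<in> {P. P \<noteq> 0 \<and> num_monomials P \<le> t + 1}"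
    then show "enat (size {#x \<in># proots P. x \<noteq> 0#}) \<le> enat ((t\<^sup>2 - t + 1) * (p ^ f - 1))"
      using num_nonzero_roots_le[of P t] assms(5,6) by (simp add: num_monomials_def support_def)
  qed
qed

end
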